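(* In the setting of the context, assume that the conditions (A1)–(A4) and (B1)–(B2) hold uniformly with respect to $n\ge1$. (i) Assume that $$\lim_{\varepsilon\to0}\ \sup_{n\ge1}\ \varepsilon^{-d/2}\int_{\mathsf{Z}^n}\exp[-c_n^\star(z^{1:n})/\varepsilon]\,d\mu^{\otimes n}(z^{1:n})=0.$$ Then $\lim_{n\to+\infty}\{\mu^{\otimes n}S_0[U]-U^\star\}=0$. (ii) Assume in addition that there exist $C_0,a,\bar\varepsilon>0$ such that for every $n\ge1$ and every $\varepsilon\in(0,\bar\varepsilon]$ $$\varepsilon^{-d/2}\int_{\mathsf{Z}^n}\exp[-c_n^\star(z^{1:n})/\varepsilon]\,d\mu^{\otimes n}(z^{1:n})\le C_0\,\varepsilon^{a}.$$ Then for every $\eta\in(0,1)$ there exist $C_\eta\ge0$ and $n_0\in\mathbb{N}$ such that for every $n\ge n_0$ $$\mu^{\otimes n}S_0[U]-U^\star\le C_\eta/\log(n)^{s\eta},\qquad s=\min(1/4,a/2).$$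
   Context: Setting. $\mathsf{Z}$ is a topological space with its Borel $\sigma$-field, $\mu$ a probability measure on $\mathsf{Z}$, $u:\mathbb{R}^d\times\mathsf{Z}\to[0,+\infty)$, $U(x)=\int_{\mathsf{Z}}u(x,z)\,d\mu(z)$ and $U^\star=\min_{\mathbb{R}^d}U$. For $n\ge1$ and $z^{1:n}=(z_1,\dots,z_n)\in\mathsf{Z}^n$, $U_n(x,z^{1:n})=\frac1n\sum_{i=1}^nu(x,z_i)$, $U_n^\star(z^{1:n})=\inf_{x}U_n(x,z^{1:n})$, $\mathsf{C}(z^{1:n})=\operatorname{argmin}_{x\in\mathbb{R}^d}U_n(x,z^{1:n})$. For each $n$ there are a measurable space $\mathsf{Y}$, a Markov kernel $R$ from $\mathsf{Z}^n$ to $\mathsf{Y}$ and a map $g:\mathbb{R}^d\times\mathsf{Y}\to\mathbb{R}^d$ with $\nabla_xU_n(x,z^{1:n})=\int_{\mathsf{Y}}g(x,y)R(z^{1:n},dy)$ for all $x,z^{1:n}$ (unbiased stochastic gradient). Limiting kernel: $S_0(z^{1:n},\cdot)$ is the probability measure on $\mathbb{R}^d$ with $S_0(z^{1:n},\mathsf{A})=\sum_{x\in\mathsf{C}(z^{1:n})\cap\mathsf{A}}\det(\nabla_x^2U_n(x,z^{1:n}))^{-1/2}\big/\sum_{x\in\mathsf{C}(z^{1:n})}\det(\nabla_x^2U_n(x,z^{1:n}))^{-1/2}$ (well-defined for $\mu^{\otimes n}$-almost every $z^{1:n}$ under the conditions below), and $\mu^{\otimes n}S_0[U]=\int_{\mathsf{Z}^n}\int_{\mathbb{R}^d}U(x)\,S_0(z^{1:n},dx)\,d\mu^{\otimes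 n}(z^{1:n})$. Thermodynamic barrier: $c_n^\star(z^{1:n})=\inf\{U_n(x,z^{1:n}): x \text{ is a local minimizer of } U_n(\cdot,z^{1:n}) \text{ but not a global minimizer}\}-U_n^\star(z^{1:n})$, and $c_n^\star(z^{1:n})=+\infty$ if there is no such local minimizer (with $\exp[-\infty]=0$). Conditions. For every $z$, $u(\cdot,z)\in C^\infty(\mathbb{R}^d,\mathbb{R})$, and: (A1) there are $A,B\ge0$ with $|u(0,z)|\le A$, $\|\nabla_xu(0,z)\|\le B$ for all $z$; (A2) there is $M\ge0$ with $\|\nabla_x^ku(x_1,z)-\nabla_x^ku(x_2,z)\|\le M\|x_1-x_2\|$ for all $x_1,x_2\in\mathbb{R}^d$, $z\in\mathsf{Z}$, $k\in\{1,2,3\}$; (A3) there are $\mathtt{m}>0$, $\mathtt{c}\ge0$ with $\langle\nabla_xu(x,z),x\rangle\ge\mathtt{m}\|x\|^2-\mathtt{c}$ for all $x,z$; (A4) there is $\kappa\ge0$ with $\int_{\mathsf{Z}^n}\int_{\mathsf{Y}}\|\nabla_xU_n(x,z^{1:n})-g(x,y)\|^2R(z^{1:n},dy)\,d\mu^{\otimes n}(z^{1:n})\le\kappa(1+\|x\|^2)$ for all $x\in\mathbb{R}^d$. Moreover $u$ is continuous on $\mathbb{R}^d\times\mathsf{Z}$ and: (B1) $\mathsf{Z}$ is compact; (B2) for every $\beta>0$, $\int_{\mathsf{Z}^n}\sigma^\star_\beta(z^{1:n})\,d\mu^{\otimes n}(z^{1:n})<+\infty$, where $\sigma^\star_\beta(z^{1:n})=\sum_{x\in\mathsf{C}(z^{1:n})}\det(\nabla_x^2U_n(x,z^{1:n}))^{-\beta}$.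 "Uniformly with respect to $n$" means that (A1)–(A4), (B1)–(B2) hold for every $n\ge1$ with constants $A,B,M,\mathtt{m},\mathtt{c},\kappa$ not depending on $n$, and that for each $\beta>0$ the integral in (B2) is bounded uniformly in $n$. *)

theory Defs
  imports "HOL-Probability.Probability"
begin

text \<open>
  \<open>\<real>\<^sup>d\<close> is \<^typ>\<open>real ^ 'd\<close>, with \<open>d = CARD('d)\<close>. The tensors \<open>\<nabla>\<^sup>k f\<close>, \<open>k = 1, 2, 3\<close>, are nested
  vectors, so \<^const>\<open>norm\<close> on them is the Euclidean (Frobenius) norm of the array of partial
  derivatives. It differs from the operator norm only by factors depending on \<open>d\<close>.
\<close>

definition grad :: "(real ^ 'd \<Rightarrow> real) \<Rightarrow> real ^ 'd \<Rightarrow> real ^ 'd" where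
  "grad f x = (\<chi> i. frechet_derivative f (at x) (axis i 1))"

definition hessian :: "(real ^ 'd \<Rightarrow> real) \<Rightarrow> real ^ 'd \<Rightarrow> real ^ 'd ^ 'd" where
  "hessian f x = (\<chi> i. grad (\<lambda>y. grad f y $ i) x)"

definition third_deriv :: "(real ^ 'd \<Rightarrow> real) \<Rightarrow> real ^ 'd \<Rightarrow> real ^ 'd ^ 'd ^ 'd" where
  "third_deriv f x = (\<chi> i. hessian (\<lambda>y. grad f y $ i) x)"

primrec C_k :: "nat \<Rightarrow> (real ^ 'd \<Rightarrow> real) \<Rightarrow> bool" where
  "C_k 0 f \<longleftrightarrow> continuous_on UNIV f"
| "C_k (Suc k) f \<longleftrightarrow> (\<forall>x. f differentiable (at x)) \<and> (\<forall>i. C_k k (\<lambda>x. grad f x $ i))"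

definition smooth :: "(real ^ 'd \<Rightarrow> real) \<Rightarrow> bool" where
  "smooth f \<longleftrightarrow> (\<forall>k. C_k k f)"

definition argmin_set :: "('a \<Rightarrow> real) \<Rightarrow> 'a set" where
  "argmin_set f = {x. is_arg_min f (\<lambda>_. True) x}"

definition local_minimizer :: "('a::topological_space \<Rightarrow> real) \<Rightarrow> 'a \<Rightarrow> bool" where
  "local_minimizer f x \<longleftrightarrow> (\<forall>\<^sub>F y in nhds x. f x \<le> f y)"

definition pop_risk :: "'z measure \<Rightarrow> (real ^ 'd \<Rightarrow> 'z \<Rightarrow> real) \<Rightarrow> real ^ 'd \<Rightarrow> real" where
  "pop_risk \<mu> u x = (\<integral>z. u x z \<partial>\<mu>)"

definition emp_risk ::
    "(real ^ 'd \<Rightarrow> 'z \<Rightarrow> real) \<Rightarrow> nat \<Rightarrow> (nat \<Rightarrow> 'z) \<Rightarrow> real ^ 'd \<Rightarrow> real" where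
  "emp_risk u n z x = (1 / real n) * (\<Sum>i=1..n. u x (z i))"

text \<open>\<open>\<mu>\<^sup>\<otimes>\<^sup>n\<close>: a point \<open>(z\<^sub>1, \<dots>, z\<^sub>n)\<close> of \<open>Z\<^sup>n\<close> is a function on \<open>{1..n}\<close>.\<close>

definition sample_measure :: "'z measure \<Rightarrow> nat \<Rightarrow> (nat \<Rightarrow> 'z) measure" where
  "sample_measure \<mu> n = Pi\<^sub>M {1..n} (\<lambda>_. \<mu>)"

text \<open>
  \<open>det (\<nabla>\<^sup>2 f x)\<^sup>-\<^sup>\<beta>\<close> as an extended nonnegative number. For \<open>\<beta> > 0\<close> it is \<open>\<infinity>\<close> when the
  determinant is \<open>0\<close>: \<^term>\<open>0 powr \<beta> = (0::real)\<close> and \<^term>\<open>inverse 0 = (\<infinity>::ennreal)\<close>.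
  It is used only at minimizers, where the determinant is nonnegative.
\<close>

definition det_weight :: "real \<Rightarrow> (real ^ 'd \<Rightarrow> real) \<Rightarrow> real ^ 'd \<Rightarrow> ennreal" where
  "det_weight \<beta> f x = inverse (ennreal (det (hessian f x) powr \<beta>))"

definition sigma_star :: "real \<Rightarrow> (real ^ 'd \<Rightarrow> real) \<Rightarrow> ennreal" where
  "sigma_star \<beta> f = (\<Sum>\<^sub>\<infinity>x\<in>argmin_set f. det_weight \<beta> f x)"

text \<open>
  If the normalizing sum is infinite (a null event under the integrability condition on
  \<^const>\<open>sigma_star\<close>), all quotients are \<open>0\<close> in \<^typ>\<open>ennreal\<close> and the result is the zero measure.
\<close>

definition limit_kernel ::
    "(real ^ 'd \<Rightarrow> 'z \<Rightarrow> real) \<Rightarrow> nat \<Rightarrow> (nat \<Rightarrow> 'z) \<Rightarrow> (real ^ 'd) measure" where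
  "limit_kernel u n z = measure_of UNIV (sets borel)
     (\<lambda>A. (\<Sum>\<^sub>\<infinity>x\<in>argmin_set (emp_risk u n z) \<inter> A. det_weight (1/2) (emp_risk u n z) x) /
          (\<Sum>\<^sub>\<infinity>x\<in>argmin_set (emp_risk u n z). det_weight (1/2) (emp_risk u n z) x))"

definition limit_risk :: "'z measure \<Rightarrow> (real ^ 'd \<Rightarrow> 'z \<Rightarrow> real) \<Rightarrow> nat \<Rightarrow> real" where
  "limit_risk \<mu> u n =
     (\<integral>z. (\<integral>x. pop_risk \<mu> u x \<partial>limit_kernel u n z) \<partial>sample_measure \<mu> n)"

text \<open>The infimum over the empty set is \<open>\<infinity>\<close> in \<^typ>\<open>ereal\<close>, so the barrier is then \<open>\<infinity>\<close>.\<close>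

definition barrier :: "(real ^ 'd \<Rightarrow> real) \<Rightarrow> ereal" where
  "barrier f = (INF x\<in>{x. local_minimizer f x \<and> x \<notin> argmin_set f}. ereal (f x))
     - ereal (INF x. f x)"

definition exp_ereal :: "ereal \<Rightarrow> ennreal" where
  "exp_ereal x = (case x of ereal r \<Rightarrow> ennreal (exp r) | PInfty \<Rightarrow> \<infinity> | MInfty \<Rightarrow> 0)"

definition barrier_term ::
    "'z measure \<Rightarrow> (real ^ 'd \<Rightarrow> 'z \<Rightarrow> real) \<Rightarrow> nat \<Rightarrow> real \<Rightarrow> ennreal" where
  "barrier_term \<mu> u n \<epsilon> = ennreal (\<epsilon> powr (- real CARD('d) / 2)) *
     (\<integral>\<^sup>+ z. exp_ereal (- barrier (emp_risk u n z) / ereal \<epsilon>) \<partial>sample_measure \<mu> n)"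

end

theory Submission
  imports Defs
begin

text \<open>
  A minimizer of the empirical risk \<open>U\<^sub>n\<close> is an almost-minimizer of the population risk \<open>U\<close> as soon as
  \<open>U\<^sub>n\<close> is uniformly close to \<open>U\<close>: the excess risk is at most twice the uniform distance
  (\<open>pop_risk_argmin_le\<close>). The limiting kernel averages over the minimizers of \<open>U\<^sub>n\<close>,
  so both claims follow from a uniform law of large numbers.

  Dissipativity makes every loss increase radially outside one ball, which confines all minimizers and
  all comparisons to that ball. There the losses are bounded and Lipschitz with common constants.
  Covering the ball by a grid of mesh \<open>1/N\<close> therefore reduces the uniform deviation to an error \<open>O(1/N)\<close>
  and at most \<open>O(N\<^sup>d)\<close> deviations at single points, each of which has mean \<open>O(1 / sqrt n)\<close> by independence.
  Balancing the two yields an excess risk of order \<open>n\<close> to the power \<open>- 1 / (4d)\<close>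
  (\<open>limit_risk_polynomial_rate\<close>), which tends to \<open>0\<close> and lies below every negative power of \<open>log n\<close>.

  What remains is to justify the double integral that defines the risk of the kernel. If some minimizer
  of \<open>U\<^sub>n\<close> has a singular Hessian, then \<open>\<sigma>\<^sup>\<star>\<close> is infinite; this event is measurable, hence null by the
  integrability of \<open>\<sigma>\<^sup>\<star>\<close>. Otherwise the minimizers are isolated, so finite in number, and the kernel is a
  finite weighted average (\<open>integral_limit_kernel\<close>). Its dependence on the sample is measurable because
  the sum over minimizers is a limit of sums over grid points whose cells contain a minimizer
  (\<open>measurable_sum_minimizers\<close>).
\<close>

section \<open>Gradients, Hessians and nondegenerate minimizers\<close>

lemma grad_has_derivative:
  assumes "f differentiable (at x)"
  shows "(f has_derivative (\<lambda>v. grad f x \<bullet> v)) (at x)"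
proof -
  define D where "D = frechet_derivative f (at x)"
  have D: "(f has_derivative D) (at x)"
    using assms by (simp add: D_def frechet_derivative_works)
  have "D v = grad f x \<bullet> v" for v
  proof -
    interpret D: linear D using D by (rule has_derivative_linear)
    have "D v = D (\<Sum>i\<in>UNIV. v $ i *\<^sub>R axis i 1)"
      by (simp add: basis_expansion scalar_mult_eq_scaleR[symmetric])
    also have "\<dots> = (\<Sum>i\<in>UNIV. v $ i * D (axis i 1))"
      by (simp add: D.sum D.scale)
    also have "\<dots> = grad f x \<bullet> v"
      by (simp add: grad_def inner_vec_def D_def mult.commute)
    finally show ?thesis .
  qed
  then have "D = (\<lambda>v. grad f x \<bullet> v)" by (rule ext)
  with D show ?thesis by simp
qed

text \<open>
  A linear functional determines its representing vector, so the gradients of sums and multiples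
  below reduce to the rules for Frechet derivatives.
\<close>

lemma grad_eqI:
  assumes "(f has_derivative (\<lambda>v. w \<bullet> v)) (at x)"
  shows "grad f x = w"
proof -
  have "frechet_derivative f (at x) = (\<lambda>v. w \<bullet> v)"
    using frechet_derivative_at[OF assms] by simp
  then show ?thesis by (simp add: grad_def vec_eq_iff inner_axis)
qed

lemma grad_sum:
  assumes "\<And>i. i \<in> I \<Longrightarrow> f i differentiable (at x)"
  shows "grad (\<lambda>x. \<Sum>i\<in>I. f i x) x = (\<Sum>i\<in>I. grad (f i) x)"
  by (rule grad_eqI)
     (auto intro!: derivative_eq_intros grad_has_derivative assms simp: inner_sum_left)

lemma grad_cmult:
  assumes "f differentiable (at x)"
  shows "grad (\<lambda>x. a * f x) x = a *\<^sub>R grad f x"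
  by (rule grad_eqI) (auto intro!: derivative_eq_intros grad_has_derivative assms)

lemma C_k_sum:
  "(\<And>i. i \<in> I \<Longrightarrow> C_k k (f i)) \<Longrightarrow> C_k k (\<lambda>x. \<Sum>i\<in>I. f i x)"
proof (induction k arbitrary: f)
  case 0
  then show ?case by (auto intro!: continuous_on_sum)
next
  case (Suc k)
  have d: "f i differentiable (at x)" if "i \<in> I" for i x using Suc.prems that by simp
  have "(\<lambda>x. grad (\<lambda>x. \<Sum>i\<in>I. f i x) x $ j) = (\<lambda>x. \<Sum>i\<in>I. grad (f i) x $ j)" for j
    by (simp add: grad_sum d)
  moreover have "C_k k (\<lambda>x. \<Sum>i\<in>I. grad (f i) x $ j)" for j
    using Suc.prems by (intro Suc.IH) auto
  moreover have "(\<lambda>x. \<Sum>i\<in>I. f i x) differentiable (at x)" for x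
  proof (cases "finite I")
    case True then show ?thesis using d by (intro differentiable_sum) auto
  qed simp
  ultimately show ?case by simp
qed

lemma C_k_cmult: "C_k k f \<Longrightarrow> C_k k (\<lambda>x. a * f x)"
proof (induction k arbitrary: f)
  case 0
  then show ?case by (auto intro!: continuous_on_mult_left)
next
  case (Suc k)
  then have "(\<lambda>x. grad (\<lambda>x. a * f x) x $ j) = (\<lambda>x. a * grad f x $ j)" for j
    by (simp add: grad_cmult)
  with Suc show ?case by simp
qed

lemma smooth_emp_risk:
  assumes "\<And>z. smooth (\<lambda>x. u x z)"
  shows "smooth (emp_risk u n z)"
  using assms unfolding smooth_def emp_risk_def by (intro allI C_k_cmult C_k_sum) blast

lemma smooth_imp_differentiable: "smooth f \<Longrightarrow> f differentiable (at x)"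
  unfolding smooth_def by (metis C_k.simps(2))

lemma smooth_grad: "smooth f \<Longrightarrow> smooth (\<lambda>x. grad f x $ i)"
  unfolding smooth_def by (metis C_k.simps(2))

lemma smooth_imp_continuous: "smooth f \<Longrightarrow> continuous_on UNIV f"
  unfolding smooth_def by (metis C_k.simps(1))

lemma continuous_on_hessian_entry:
  assumes "smooth f" shows "continuous_on UNIV (\<lambda>x. hessian f x $ i $ j)"
  using smooth_imp_continuous[OF smooth_grad[OF smooth_grad[OF assms]]]
  by (simp add: hessian_def)

lemma continuous_on_det_hessian:
  assumes "smooth f" shows "continuous_on UNIV (\<lambda>x. det (hessian f x))"
  unfolding det_def by (intro continuous_intros continuous_on_hessian_entry assms)

lemma grad_has_derivative_hessian:
  assumes "smooth f"
  shows "(grad f has_derivative (\<lambda>v. hessian f x *v v)) (at x)"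
proof -
  have "((\<lambda>x. grad f x $ i) has_derivative (\<lambda>v. (hessian f x *v v) $ i)) (at x)" for i
  proof -
    have "(\<lambda>y. grad f y $ i) differentiable (at x)"
      using assms by (intro smooth_imp_differentiable smooth_grad)
    from grad_has_derivative[OF this]
    show ?thesis
      by (simp add: matrix_vector_mul_component hessian_def)
  qed
  then show ?thesis
    by (subst has_derivative_componentwise_within) (auto simp: Basis_vec_def inner_axis)
qed

lemma argmin_set_iff: "x \<in> argmin_set f \<longleftrightarrow> (\<forall>y. f x \<le> f y)"
  for f :: "'a \<Rightarrow> real"
  by (auto simp: argmin_set_def is_arg_min_def not_less)

lemma grad_argmin_eq_0:
  assumes "x \<in> argmin_set f" "f differentiable (at x)"
  shows "grad f x = 0"
proof -
  have "(\<lambda>v. grad f x \<bullet> v) = (\<lambda>v. 0)"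
    using assms by (intro has_derivative_local_min[OF grad_has_derivative])
      (auto simp: argmin_set_iff)
  then have "grad f x \<bullet> grad f x = 0" by (rule fun_cong)
  then show ?thesis by simp
qed

text \<open>
  Near \<open>x\<close> the gradient is the invertible linear map \<open>v \<mapsto> hessian f x *v v\<close> of the increment up to a
  relative error, and an injective linear map on \<open>\<real>\<^sup>d\<close> is bounded below. Hence the gradient cannot
  vanish a second time close to \<open>x\<close>.
\<close>

lemma isolated_of_det_hessian_neq_0:
  assumes f: "smooth f" and 0: "grad f x = 0" and det: "det (hessian f x) \<noteq> 0"
  shows "eventually (\<lambda>y. grad f y \<noteq> 0) (at x)"
proof -
  let ?H = "\<lambda>v. hessian f x *v v"
  have "linear ?H" "inj ?H"
    using det by (auto simp: invertible_det_nz[symmetric] inj_matrix_vector_mult)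
  then obtain b where b: "b > 0" "\<And>v. b * norm v \<le> norm (?H v)"
    by (metis linear_inj_bounded_below_pos)
  from grad_has_derivative_hessian[OF f, of x] b(1)
  obtain d where d: "d > 0"
    "\<And>y. norm (y - x) < d \<Longrightarrow> norm (grad f y - grad f x - ?H (y - x)) \<le> b/2 * norm (y - x)"
    unfolding has_derivative_at_alt by (meson half_gt_zero)
  have "grad f y \<noteq> 0" if y: "y \<noteq> x" "dist y x < d" for y
  proof
    assume "grad f y = 0"
    with d(2)[of y] y 0 have "norm (?H (y - x)) \<le> b/2 * norm (y - x)"
      by (simp add: dist_norm)
    with b(2)[of "y - x"] have "b/2 * norm (y - x) \<le> 0" by simp
    with b(1) y show False by (simp add: mult_le_0_iff)
  qed
  with d(1) show ?thesis unfolding eventually_at by blast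
qed

lemma compact_argmin:
  fixes f :: "real ^ 'd \<Rightarrow> real"
  assumes f: "continuous_on UNIV f" and K: "argmin_set f \<subseteq> K" "bounded K"
  shows "compact (argmin_set f)"
proof -
  have "argmin_set f = (\<Inter>y. {x. f x \<le> f y})" by (auto simp: argmin_set_iff)
  moreover have "closed (\<Inter>y. {x. f x \<le> f y})"
    using f by (intro closed_INT ballI closed_Collect_le) auto
  ultimately show ?thesis
    using K by (metis bounded_subset compact_eq_bounded_closed)
qed

text \<open>
  An infinite subset of a compact set has an accumulation point in it, but a minimizer with
  invertible Hessian is isolated among the zeros of the gradient.
\<close>

lemma finite_argmin:
  fixes f :: "real ^ 'd \<Rightarrow> real"
  assumes f: "smooth f" and K: "argmin_set f \<subseteq> K" "bounded K"
    and nd: "\<And>x. x \<in> argmin_set f \<Longrightarrow> det (hessian f x) \<noteq> 0"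
  shows "finite (argmin_set f)"
proof (rule ccontr)
  assume "infinite (argmin_set f)"
  with compact_argmin[OF smooth_imp_continuous[OF f] K]
  obtain x where x: "x \<in> argmin_set f" "x islimpt argmin_set f"
    unfolding compact_eq_Bolzano_Weierstrass by blast
  have g: "grad f y = 0" if "y \<in> argmin_set f" for y
    using that f by (intro grad_argmin_eq_0 smooth_imp_differentiable)
  have "eventually (\<lambda>y. grad f y \<noteq> 0) (at x)"
    using x f by (intro isolated_of_det_hessian_neq_0 g nd)
  then have "eventually (\<lambda>y. y \<notin> argmin_set f) (at x)"
    by eventually_elim (use g in auto)
  with x(2) show False by (simp add: islimpt_conv_frequently_at frequently_def)
qed

section \<open>The limiting kernel as a finite weighted average\<close>

text \<open>
  The real-valued form of \<^term>\<open>det_weight (1/2)\<close>, to which it corresponds only where the Hessian is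
  invertible; at a degenerate point the quotient \<open>1 / 0 = 0\<close> is a default value.
\<close>

definition gibbs_weight :: "(real ^ 'd \<Rightarrow> real) \<Rightarrow> real ^ 'd \<Rightarrow> real" where
  "gibbs_weight f x = 1 / (det (hessian f x) powr (1/2))"

lemma det_weight_degenerate: "\<beta> > 0 \<Longrightarrow> det (hessian f x) = 0 \<Longrightarrow> det_weight \<beta> f x = \<infinity>"
  by (simp add: det_weight_def)

lemma gibbs_weight_nonneg: "gibbs_weight f x \<ge> 0"
  by (simp add: gibbs_weight_def)

lemma gibbs_weight_pos: "det (hessian f x) \<noteq> 0 \<Longrightarrow> gibbs_weight f x > 0"
  by (simp add: gibbs_weight_def)

lemma det_weight_half:
  assumes "det (hessian f x) \<noteq> 0"
  shows "det_weight (1/2) f x = ennreal (gibbs_weight f x)"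
proof -
  have "det (hessian f x) powr (1/2) > 0" using assms by simp
  then show ?thesis
    unfolding det_weight_def gibbs_weight_def by (simp only: inverse_ennreal inverse_eq_divide)
qed

text \<open>
  This is what turns integrability of \<^const>\<open>sigma_star\<close> into almost sure nondegeneracy: one degenerate
  minimizer makes the whole sum infinite.
\<close>

lemma infsum_ennreal_eq_top:
  fixes g :: "'a \<Rightarrow> ennreal"
  assumes "x \<in> S" "g x = \<infinity>"
  shows "(\<Sum>\<^sub>\<infinity>x\<in>S. g x) = \<infinity>"
proof -
  have "(\<Sum>\<^sub>\<infinity>x\<in>{x}. g x) \<le> (\<Sum>\<^sub>\<infinity>x\<in>S. g x)"
    using assms(1) by (intro infsum_mono_neutral nonneg_summable_on_complete) auto
  with assms(2) show ?thesis by (simp add: top_unique)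
qed

lemma sigma_star_degenerate:
  "\<beta> > 0 \<Longrightarrow> x \<in> argmin_set f \<Longrightarrow> det (hessian f x) = 0 \<Longrightarrow> sigma_star \<beta> f = \<infinity>"
  unfolding sigma_star_def by (rule infsum_ennreal_eq_top[where x = x and g = "det_weight \<beta> f"])
    (assumption | rule det_weight_degenerate)+

text \<open>
  An infinite normalizing sum makes every quotient \<open>0\<close> in \<^typ>\<open>ennreal\<close>.
\<close>

lemma limit_kernel_degenerate:
  assumes "x \<in> argmin_set (emp_risk u n z)" "det (hessian (emp_risk u n z) x) = 0"
  shows "limit_kernel u n z = null_measure borel"
proof -
  have "(\<Sum>\<^sub>\<infinity>x\<in>argmin_set (emp_risk u n z). det_weight (1/2) (emp_risk u n z) x) = \<infinity>"
    using sigma_star_degenerate[of "1/2", OF _ assms] by (simp add: sigma_star_def)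
  then show ?thesis
    by (simp only: limit_kernel_def infinity_ennreal_def ennreal_divide_top null_measure_def
        space_borel sets_borel)
qed

text \<open>
  Finitely many finite weights form a discrete measure; \<^const>\<open>limit_kernel\<close> has the same set function
  on Borel sets and is therefore that measure transported to the Borel \<open>\<sigma>\<close>-algebra. In particular
  its set function really is a measure.
\<close>

lemma limit_kernel_nondegenerate:
  fixes u :: "real ^ 'd \<Rightarrow> 'z \<Rightarrow> real" and n z
  defines "f \<equiv> emp_risk u n z"
  assumes fin: "finite (argmin_set f)" and ne: "argmin_set f \<noteq> {}"
    and nd: "\<And>x. x \<in> argmin_set f \<Longrightarrow> det (hessian f x) \<noteq> 0"
  defines "W \<equiv> \<Sum>x\<in>argmin_set f. gibbs_weight f x"
  shows "limit_kernel u n z =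
    distr (point_measure (argmin_set f) (\<lambda>x. gibbs_weight f x / W)) borel (\<lambda>x. x)" (is "_ = ?P")
proof -
  have W: "W > 0" using fin ne nd unfolding W_def by (intro sum_pos gibbs_weight_pos) auto
  have s: "(\<Sum>\<^sub>\<infinity>x\<in>A. det_weight (1/2) f x) = ennreal (\<Sum>x\<in>A. gibbs_weight f x)"
    if "A \<subseteq> argmin_set f" for A
  proof -
    have "(\<Sum>\<^sub>\<infinity>x\<in>A. det_weight (1/2) f x) = (\<Sum>x\<in>A. det_weight (1/2) f x)"
      using fin that by (intro infsum_finite) (auto intro: finite_subset)
    also have "\<dots> = (\<Sum>x\<in>A. ennreal (gibbs_weight f x))"
      using nd that by (intro sum.cong refl det_weight_half) auto
    finally show ?thesis by (simp add: sum_ennreal gibbs_weight_nonneg)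
  qed
  have "limit_kernel u n z = measure_of (space ?P) (sets ?P) (emeasure ?P)"
    unfolding limit_kernel_def space_distr sets_distr space_borel
  proof (rule measure_of_eq)
    fix A :: "(real ^ 'd) set" assume "A \<in> sigma_sets UNIV (sets borel)"
    then have A: "A \<in> sets borel"
      by (metis sets.sigma_sets_eq space_borel)
    have "(\<Sum>\<^sub>\<infinity>x\<in>argmin_set f \<inter> A. det_weight (1/2) f x) /
        (\<Sum>\<^sub>\<infinity>x\<in>argmin_set f. det_weight (1/2) f x)
      = ennreal (\<Sum>x\<in>argmin_set f \<inter> A. gibbs_weight f x) / ennreal W"
      by (simp add: s W_def)
    also have "\<dots> = ennreal (\<Sum>x\<in>argmin_set f \<inter> A. gibbs_weight f x / W)"
      using W by (simp add: divide_ennreal sum_nonneg gibbs_weight_nonneg sum_divide_distrib)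
    also have "\<dots> = emeasure ?P A"
      using fin A W
      by (subst emeasure_distr)
        (auto simp: space_point_measure emeasure_point_measure_finite sum_ennreal gibbs_weight_nonneg
          Int_commute intro!: measurable_point_measure_eq1[THEN iffD2])
    finally show "(\<Sum>\<^sub>\<infinity>x\<in>argmin_set (emp_risk u n z) \<inter> A. det_weight (1/2) (emp_risk u n z) x) /
        (\<Sum>\<^sub>\<infinity>x\<in>argmin_set (emp_risk u n z). det_weight (1/2) (emp_risk u n z) x) = emeasure ?P A"
      by (simp add: f_def)
  qed (rule sets.space_closed[of borel, unfolded space_borel])
  then show ?thesis unfolding measure_of_of_measure .
qed

lemma integral_limit_kernel:
  fixes u :: "real ^ 'd \<Rightarrow> 'z \<Rightarrow> real" and n z and h :: "real ^ 'd \<Rightarrow> real"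
  defines "f \<equiv> emp_risk u n z"
  assumes fin: "finite (argmin_set f)" and ne: "argmin_set f \<noteq> {}"
    and nd: "\<And>x. x \<in> argmin_set f \<Longrightarrow> det (hessian f x) \<noteq> 0"
    and h: "h \<in> borel_measurable borel"
  shows "(\<integral>x. h x \<partial>limit_kernel u n z) =
    (\<Sum>x\<in>argmin_set f. gibbs_weight f x * h x) / (\<Sum>x\<in>argmin_set f. gibbs_weight f x)"
proof -
  let ?W = "\<Sum>x\<in>argmin_set f. gibbs_weight f x"
  have W: "?W \<ge> 0" by (simp add: sum_nonneg gibbs_weight_nonneg)
  have "(\<integral>x. h x \<partial>limit_kernel u n z) =
      (\<integral>x. h x \<partial>point_measure (argmin_set f) (\<lambda>x. gibbs_weight f x / ?W))"
    using fin ne nd h unfolding f_def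
    by (subst limit_kernel_nondegenerate)
       (auto simp: integral_distr measurable_point_measure_eq1)
  also have "\<dots> = (\<Sum>x\<in>argmin_set f. gibbs_weight f x / ?W * h x)"
    using fin W by (subst lebesgue_integral_point_measure_finite) (auto simp: gibbs_weight_nonneg)
  also have "\<dots> = (\<Sum>x\<in>argmin_set f. gibbs_weight f x * h x) / ?W"
    by (simp add: sum_divide_distrib)
  finally show ?thesis .
qed

section \<open>Grids and measurability of zero conditions\<close>

text \<open>
  The grid \<open>(1/N) \<int>\<^sup>d\<close> has two uses: its points within a ball form a net for the uniform law of large
  numbers, and its half-open cells separate finitely many points, which gives measurability of sums
  over a random finite set.
\<close>

definition grid_round :: "nat \<Rightarrow> real ^ 'd \<Rightarrow> real ^ 'd" where
  "grid_round N x = (\<chi> i. real_of_int \<lfloor>real N * x $ i\<rfloor> / real N)"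

definition grid_box :: "nat \<Rightarrow> int \<Rightarrow> (real ^ 'd) set" where
  "grid_box N k = (\<lambda>a. \<chi> i. real_of_int (a i) / real N) ` (UNIV \<rightarrow>\<^sub>E {-k..k})"

lemma finite_grid_box: "finite (grid_box N k)"
  unfolding grid_box_def by (intro finite_imageI finite_PiE) auto

lemma card_grid_box: "card (grid_box N k :: (real ^ 'd) set) \<le> nat (2 * k + 1) ^ CARD('d)"
proof -
  have "card (grid_box N k :: (real ^ 'd) set) \<le> card (UNIV \<rightarrow>\<^sub>E {-k..k} :: ('d \<Rightarrow> int) set)"
    unfolding grid_box_def by (intro card_image_le finite_PiE) auto
  also have "\<dots> = nat (2 * k + 1) ^ CARD('d)" by (simp add: card_funcsetE)
  finally show ?thesis .
qed

lemma dist_grid_round: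
  assumes "N \<ge> 1"
  shows "dist (grid_round N x) (x :: real ^ 'd) \<le> real CARD('d) / real N"
proof -
  have "\<bar>(grid_round N x - x) $ i\<bar> \<le> 1 / real N" for i
  proof -
    have "\<bar>real_of_int \<lfloor>real N * x $ i\<rfloor> - real N * x $ i\<bar> \<le> 1" by linarith
    moreover have "(grid_round N x - x) $ i
        = (real_of_int \<lfloor>real N * x $ i\<rfloor> - real N * x $ i) / real N"
      using assms by (simp add: grid_round_def diff_divide_distrib)
    ultimately show ?thesis by (simp add: abs_divide divide_right_mono)
  qed
  then have "(\<Sum>i\<in>UNIV. \<bar>(grid_round N x - x) $ i\<bar>) \<le> of_nat CARD('d) * (1 / real N)"
    by (intro sum_bounded_above)
  with norm_le_l1_cart[of "grid_round N x - x"] show ?thesis by (simp add: dist_norm)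
qed

lemma tendsto_grid_round: "(\<lambda>N. grid_round N x) \<longlonglongrightarrow> (x :: real ^ 'd)"
proof (rule metric_tendsto_imp_tendsto)
  show "(\<lambda>N. real CARD('d) / real N) \<longlonglongrightarrow> 0" by real_asymp
  show "\<forall>\<^sub>F N in sequentially. dist (grid_round N x) x \<le> dist (real CARD('d) / real N) 0"
    using eventually_ge_at_top[of "1::nat"] by eventually_elim (simp add: dist_grid_round)
qed

lemma grid_round_in_box:
  assumes "norm x \<le> r" "r \<ge> 0"
  shows "grid_round N x \<in> grid_box N (\<lceil>real N * r\<rceil> + 1)"
proof -
  have "\<lfloor>real N * x $ i\<rfloor> \<in> {- (\<lceil>real N * r\<rceil> + 1)..\<lceil>real N * r\<rceil> + 1}" for i
  proof -
    have "\<bar>x $ i\<bar> \<le> r" using component_le_norm_cart[of x i] assms by linarith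
    then have "\<bar>real N * x $ i\<bar> \<le> real N * r" by (simp add: abs_mult mult_left_mono)
    then show ?thesis by simp linarith
  qed
  then show ?thesis
    unfolding grid_box_def grid_round_def by (intro image_eqI[where x = "\<lambda>i. \<lfloor>real N * x $ i\<rfloor>"]) auto
qed

text \<open>
  Half-open cubes are needed because they partition the space, compact sets because the event that
  some minimizer lies in a given set is measurable by a direct argument for these. Increasing closed
  subcubes with the same lower corner reconcile the two.
\<close>

lemma grid_cell_eq_Union_compact:
  assumes "N \<ge> 1"
  obtains K :: "nat \<Rightarrow> (real ^ 'd) set"
  where "\<And>j. compact (K j)" "{x. grid_round N x = q} = (\<Union>j. K j)"
proof (cases "\<exists>a. q = (\<chi> i. real_of_int (a i) / real N)")
  case False
  then have "{x. grid_round N x = q} = (\<Union>j::nat. {})" by (auto simp: grid_round_def)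
  then show ?thesis by (metis that compact_empty)
next
  case True
  then obtain a where q: "q = (\<chi> i. real_of_int (a i) / real N)" by blast
  define K where "K j = cbox q (\<chi> i. (real_of_int (a i) + 1 - 1 / real (Suc j)) / real N)" for j
  have N: "real N > 0" using assms by simp
  have cell: "grid_round N x = q \<longleftrightarrow> (\<forall>i. real_of_int (a i) \<le> real N * x $ i \<and> real N * x $ i < real_of_int (a i) + 1)" for x
    using N by (simp add: q grid_round_def vec_eq_iff floor_eq_iff)
  have K: "x \<in> K j \<longleftrightarrow> (\<forall>i. real_of_int (a i) \<le> real N * x $ i \<and> real N * x $ i \<le> real_of_int (a i) + 1 - 1 / real (Suc j))" for x j
    using N by (simp add: K_def mem_box_cart q pos_divide_le_eq pos_le_divide_eq mult.commute)
  have "{x. grid_round N x = q} = (\<Union>j. K j)"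
  proof (intro equalityI subsetI)
    fix x assume "x \<in> {x. grid_round N x = q}"
    then have x: "real_of_int (a i) \<le> real N * x $ i" "real N * x $ i < real_of_int (a i) + 1" for i
      by (auto simp: cell)
    have "\<forall>i. \<forall>\<^sub>F j in sequentially. real N * x $ i \<le> real_of_int (a i) + 1 - 1 / real (Suc j)"
    proof
      fix i
      have "(\<lambda>j. real_of_int (a i) + 1 - 1 / real (Suc j)) \<longlonglongrightarrow> real_of_int (a i) + 1" by real_asymp
      from order_tendstoD(1)[OF this x(2)]
      show "\<forall>\<^sub>F j in sequentially. real N * x $ i \<le> real_of_int (a i) + 1 - 1 / real (Suc j)"
        by eventually_elim simp
    qed
    then have "\<forall>\<^sub>F j in sequentially. \<forall>i. real N * x $ i \<le> real_of_int (a i) + 1 - 1 / real (Suc j)"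
      by (simp add: eventually_all_finite)
    then obtain j where "\<forall>i. real N * x $ i \<le> real_of_int (a i) + 1 - 1 / real (Suc j)"
      by (auto dest: eventually_happens)
    with x show "x \<in> (\<Union>j. K j)" by (auto simp only: UN_iff K)
  next
    fix x assume "x \<in> (\<Union>j. K j)"
    then obtain j where "x \<in> K j" by blast
    then have "real_of_int (a i) \<le> real N * x $ i \<and> real N * x $ i < real_of_int (a i) + 1" for i
    proof -
      have "1 / real (Suc j) > 0" by simp
      moreover have "real_of_int (a i) \<le> real N * x $ i"
        "real N * x $ i \<le> real_of_int (a i) + 1 - 1 / real (Suc j)"
        using \<open>x \<in> K j\<close> unfolding K by blast+
      ultimately show ?thesis by linarith
    qed
    then show "x \<in> {x. grid_round N x = q}" by (simp add: cell)
  qed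
  moreover have "compact (K j)" for j by (simp add: K_def compact_cbox)
  ultimately show ?thesis by (metis that)
qed

text \<open>
  The existential quantifier over the uncountable set \<open>K\<close> becomes countable: by compactness a
  nonnegative continuous function has a zero on \<open>K\<close> iff it takes arbitrarily small values on a
  countable dense subset.
\<close>

lemma measurable_ex_compact_zero:
  fixes F :: "'b::metric_space \<Rightarrow> 'a \<Rightarrow> real"
  assumes K: "compact K" and D: "countable D" "D \<subseteq> K" "K \<subseteq> closure D"
    and c: "\<And>z. z \<in> space M \<Longrightarrow> continuous_on K (\<lambda>x. F x z)"
    and m [measurable]: "\<And>x. F x \<in> borel_measurable M"
    and nn: "\<And>x z. x \<in> K \<Longrightarrow> z \<in> space M \<Longrightarrow> F x z \<ge> 0"
  shows "{z \<in> space M. \<exists>x\<in>K. F x z = 0} \<in> sets M"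
proof -
  have "(\<exists>x\<in>K. F x z = 0) \<longleftrightarrow> (\<forall>j::nat. \<exists>x\<in>D. F x z < 1 / real (Suc j))" if z: "z \<in> space M" for z
  proof
    assume "\<exists>x\<in>K. F x z = 0"
    then obtain x where x: "x \<in> K" "F x z = 0" by blast
    with D obtain s where s: "\<And>k. s k \<in> D" "s \<longlonglongrightarrow> x"
      by (meson closure_sequential subsetD)
    have "(\<lambda>k. F (s k) z) \<longlonglongrightarrow> F x z"
      using c[OF z] s D(2) x(1) by (auto simp: continuous_on_sequentially o_def)
    then have "\<forall>\<^sub>F k in sequentially. F (s k) z < 1 / real (Suc j)" for j
      using x(2) by (intro order_tendstoD(2)) auto
    then show "\<forall>j. \<exists>x\<in>D. F x z < 1 / real (Suc j)"
      using s(1) by (meson eventually_happens' sequentially_bot)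
  next
    assume *: "\<forall>j::nat. \<exists>x\<in>D. F x z < 1 / real (Suc j)"
    then have "K \<noteq> {}" using D by blast
    with K c[OF z] obtain x where x: "x \<in> K" "\<And>y. y \<in> K \<Longrightarrow> F x z \<le> F y z"
      by (metis continuous_attains_inf)
    have "F x z \<le> 1 / real (Suc j)" for j
      using * x(2) D(2) by (meson less_eq_real_def order_trans subsetD)
    moreover have "(\<lambda>j. 1 / real (Suc j)) \<longlonglongrightarrow> 0" by real_asymp
    ultimately have "F x z \<le> 0" by (intro LIMSEQ_le_const) auto
    with nn[OF x(1) z] x(1) show "\<exists>x\<in>K. F x z = 0" by force
  qed
  then have "{z \<in> space M. \<exists>x\<in>K. F x z = 0}
      = {z \<in> space M. \<forall>j::nat. \<exists>x\<in>D. F x z < 1 / real (Suc j)}" by auto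
  also have "\<dots> \<in> sets M" using D(1) by measurable
  finally show ?thesis .
qed

text \<open>
  A partial derivative is the limit of difference quotients along a fixed sequence of steps.
\<close>

lemma measurable_grad:
  fixes f :: "real ^ 'd \<Rightarrow> 'a \<Rightarrow> real"
  assumes m [measurable]: "\<And>x. f x \<in> borel_measurable M"
    and d: "\<And>z. z \<in> space M \<Longrightarrow> (\<lambda>x. f x z) differentiable (at x)"
  shows "(\<lambda>z. grad (\<lambda>x. f x z) x $ i) \<in> borel_measurable M"
proof (rule borel_measurable_LIMSEQ_real)
  define h where "h j = 1 / real (Suc j)" for j
  show "(\<lambda>z. (f (x + h j *\<^sub>R axis i 1) z - f x z) / h j) \<in> borel_measurable M" for j
    by measurable
  fix z assume z: "z \<in> space M"
  have "((\<lambda>t. f (x + t *\<^sub>R axis i 1) z) has_derivative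
      (\<lambda>t. grad (\<lambda>x. f x z) x \<bullet> (t *\<^sub>R axis i 1))) (at 0)"
    by (rule has_derivative_compose[where g = "\<lambda>x. f x z"])
       (auto intro!: derivative_eq_intros grad_has_derivative d z)
  then have "((\<lambda>t. f (x + t *\<^sub>R axis i 1) z) has_field_derivative grad (\<lambda>x. f x z) x $ i) (at 0)"
    by (simp add: has_field_derivative_def inner_axis mult_commute_abs)
  then have "((\<lambda>t. (f (x + t *\<^sub>R axis i 1) z - f x z) / t) \<longlongrightarrow> grad (\<lambda>x. f x z) x $ i) (at 0)"
    by (simp add: DERIV_def)
  moreover have "filterlim h (at 0) sequentially"
    unfolding h_def by real_asymp
  ultimately show "(\<lambda>j. (f (x + h j *\<^sub>R axis i 1) z - f x z) / h j) \<longlonglongrightarrow> grad (\<lambda>x. f x z) x $ i"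
    by (rule filterlim_compose)
qed

section \<open>Random functions and their sets of minimizers\<close>

text \<open>
  A random smooth function all of whose minimizers exist and lie in a fixed ball. The integral
  defining \<^const>\<open>limit_risk\<close> is \<open>0\<close> by convention for a nonmeasurable integrand, so the convergence
  proof needs genuine measurability in the sample of sums over the random set of minimizers. That set
  is a random closed set; the facts below use only its hitting events.
\<close>

locale random_landscape =
  fixes M :: "'a measure" and f :: "real ^ 'd \<Rightarrow> 'a \<Rightarrow> real" and r :: real
  assumes f_measurable [measurable]: "\<And>x. f x \<in> borel_measurable M"
    and f_smooth: "\<And>z. z \<in> space M \<Longrightarrow> smooth (\<lambda>x. f x z)"
    and r_nonneg: "r \<ge> 0"
    and argmin_nonempty: "\<And>z. z \<in> space M \<Longrightarrow> argmin_set (\<lambda>x. f x z) \<noteq> {}"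
    and argmin_bounded: "\<And>z. z \<in> space M \<Longrightarrow> argmin_set (\<lambda>x. f x z) \<subseteq> cball 0 r"
begin

abbreviation minimizers :: "'a \<Rightarrow> (real ^ 'd) set" where
  "minimizers z \<equiv> argmin_set (\<lambda>x. f x z)"

abbreviation det_hess :: "'a \<Rightarrow> real ^ 'd \<Rightarrow> real" where
  "det_hess z x \<equiv> det (hessian (\<lambda>x. f x z) x)"

definition degenerate :: "'a set" where
  "degenerate = {z \<in> space M. \<exists>x\<in>minimizers z. det_hess z x = 0}"

lemma measurable_det_hess [measurable]: "(\<lambda>z. det_hess z x) \<in> borel_measurable M"
proof -
  have "(\<lambda>z. hessian (\<lambda>x. f x z) x $ i $ j) \<in> borel_measurable M" for i j
    unfolding hessian_def vec_lambda_beta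
    by (intro measurable_grad smooth_imp_differentiable smooth_grad f_smooth f_measurable)
  then show ?thesis unfolding det_def by measurable
qed

lemma measurable_gibbs_weight [measurable]:
  "(\<lambda>z. gibbs_weight (\<lambda>x. f x z) x) \<in> borel_measurable M"
  unfolding gibbs_weight_def by measurable

lemma min_value_eq: "x \<in> minimizers z \<Longrightarrow> (INF y. f y z) = f x z"
  by (rule cInf_eq_minimum) (auto simp: argmin_set_iff)

lemma min_value_le:
  assumes "z \<in> space M" shows "(INF y. f y z) \<le> f x z"
proof -
  obtain x0 where x0: "x0 \<in> minimizers z" using argmin_nonempty[OF assms] by blast
  then have "f x0 z \<le> f x z" unfolding argmin_set_iff by blast
  then show ?thesis using min_value_eq[OF x0] by (simp only:)
qed

lemma minimizer_iff:
  assumes z: "z \<in> space M"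
  shows "x \<in> minimizers z \<longleftrightarrow> f x z - (INF y. f y z) = 0"
proof
  assume "f x z - (INF y. f y z) = 0"
  then have "f x z \<le> f y z" for y using min_value_le[OF z, of y] by simp
  then show "x \<in> minimizers z" by (simp add: argmin_set_iff)
next
  assume "x \<in> minimizers z"
  from min_value_eq[OF this] show "f x z - (INF y. f y z) = 0" by simp
qed

lemma f_continuous: "z \<in> space M \<Longrightarrow> continuous_on S (\<lambda>x. f x z)"
  by (rule continuous_on_subset[OF smooth_imp_continuous[OF f_smooth] subset_UNIV])

text \<open>
  By continuity, a lower bound on a countable dense set is a lower bound everywhere.
\<close>

lemma measurable_min_value [measurable]: "(\<lambda>z. INF y. f y z) \<in> borel_measurable M"
proof -
  obtain S :: "(real ^ 'd) set" where S: "countable S" "UNIV \<subseteq> closure S"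
    by (rule separable[of UNIV])
  have iff: "a \<le> (INF y. f y z) \<longleftrightarrow> (\<forall>x\<in>S. a \<le> f x z)" if z: "z \<in> space M" for a z
  proof
    assume "a \<le> (INF y. f y z)"
    then show "\<forall>x\<in>S. a \<le> f x z" by (intro ballI order_trans[OF _ min_value_le[OF z]])
  next
    assume "\<forall>x\<in>S. a \<le> f x z"
    moreover have "closed {x. a \<le> f x z}"
      using f_continuous[OF z] by (intro closed_Collect_le) auto
    ultimately have "closure S \<subseteq> {x. a \<le> f x z}" by (intro closure_minimal) auto
    with S(2) have "a \<le> f x z" for x by blast
    then show "a \<le> (INF y. f y z)" by (intro cINF_greatest) simp_all
  qed
  have "{z \<in> space M. a \<le> (INF y. f y z)} = {z \<in> space M. \<forall>x\<in>S. a \<le> f x z}" for a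
    by (simp only: iff cong: conj_cong)
  moreover have "{z \<in> space M. \<forall>x\<in>S. a \<le> f x z} \<in> sets M" for a
    using S(1) by measurable
  ultimately show ?thesis by (simp only: borel_measurable_iff_ge simp_thms)
qed

text \<open>
  Membership in the set of minimizers is itself a zero condition, namely that the excess over the
  minimum vanishes; adding the nonnegative \<open>h\<close> expresses both conditions by a single zero.
\<close>

lemma measurable_ex_minimizer:
  fixes h :: "real ^ 'd \<Rightarrow> 'a \<Rightarrow> real"
  assumes K: "compact K"
    and m [measurable]: "\<And>x. h x \<in> borel_measurable M"
    and c: "\<And>z. z \<in> space M \<Longrightarrow> continuous_on K (\<lambda>x. h x z)"
    and nn: "\<And>x z. h x z \<ge> 0"
  shows "{z \<in> space M. \<exists>x\<in>K. x \<in> minimizers z \<and> h x z = 0} \<in> sets M"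
proof -
  obtain D where D: "countable D" "D \<subseteq> K" "K \<subseteq> closure D" by (rule separable[of K])
  define F where "F x z = (f x z - (INF y. f y z)) + h x z" for x z
  have "{z \<in> space M. \<exists>x\<in>K. F x z = 0} \<in> sets M"
  proof (rule measurable_ex_compact_zero[OF K D])
    show "continuous_on K (\<lambda>x. F x z)" if "z \<in> space M" for z
      unfolding F_def by (intro continuous_intros f_continuous c that)
    show "F x \<in> borel_measurable M" for x unfolding F_def by measurable
    show "F x z \<ge> 0" if "z \<in> space M" for x z
      using min_value_le[OF that, of x] nn[of x z] by (simp add: F_def)
  qed
  moreover have "x \<in> minimizers z \<and> h x z = 0 \<longleftrightarrow> F x z = 0" if "z \<in> space M" for x z
    using min_value_le[OF that, of x] nn[of x z] minimizer_iff[OF that, of x]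
    by (auto simp: F_def)
  ultimately show ?thesis by (simp cong: conj_cong)
qed

lemma degenerate_measurable [measurable]: "degenerate \<in> sets M"
proof -
  have "degenerate = {z \<in> space M. \<exists>x\<in>cball 0 r. x \<in> minimizers z \<and> \<bar>det_hess z x\<bar> = 0}"
    unfolding degenerate_def using argmin_bounded by (intro Collect_cong) (auto simp del: mem_cball_0)
  also have "\<dots> \<in> sets M"
    by (rule measurable_ex_minimizer)
       (auto intro!: continuous_on_rabs continuous_on_subset[OF continuous_on_det_hessian] f_smooth)
  finally show ?thesis .
qed

lemma measurable_ex_minimizer_in_cell [measurable]:
  assumes "N \<ge> 1"
  shows "{z \<in> space M. \<exists>x\<in>minimizers z. grid_round N x = q} \<in> sets M"
proof -
  obtain K :: "nat \<Rightarrow> (real ^ 'd) set"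
    where K: "\<And>j. compact (K j)" "{x. grid_round N x = q} = (\<Union>j. K j)"
    using grid_cell_eq_Union_compact[OF assms] by metis
  have "(\<exists>x\<in>minimizers z. grid_round N x = q) \<longleftrightarrow> (\<exists>j. \<exists>x\<in>K j. x \<in> minimizers z)" for z
    using K(2) by blast
  then have "{z \<in> space M. \<exists>x\<in>minimizers z. grid_round N x = q} =
      (\<Union>j. {z \<in> space M. \<exists>x\<in>K j. x \<in> minimizers z \<and> (0::real) = 0})" by auto
  also have "\<dots> \<in> sets M"
    by (intro sets.countable_UN image_subsetI
        measurable_ex_minimizer[where h = "\<lambda>_ _. 0"] K) auto
  finally show ?thesis .
qed

lemma finite_minimizers: "z \<in> space M - degenerate \<Longrightarrow> finite (minimizers z)"
  using argmin_bounded[of z]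
  by (intro finite_argmin[of _ "cball 0 r"] f_smooth) (auto simp: degenerate_def)

text \<open>
  Replace each minimizer by the corner of its grid cell. The sum then runs over a fixed finite set of
  grid points, each contributing when its cell is hit, so it is measurable. Once the grid is fine
  enough no two minimizers share a cell, and the rounded sum converges to the sum over the minimizers
  because the weight is continuous wherever the Hessian is invertible.
\<close>

lemma measurable_sum_minimizers:
  fixes h :: "real ^ 'd \<Rightarrow> real"
  assumes h: "continuous_on UNIV h"
  shows "(\<lambda>z. if z \<in> degenerate then 0
      else \<Sum>x\<in>minimizers z. gibbs_weight (\<lambda>x. f x z) x * h x) \<in> borel_measurable M"
proof (rule borel_measurable_LIMSEQ_real)
  define w where "w z x = gibbs_weight (\<lambda>x. f x z) x * h x" for z x
  define B :: "nat \<Rightarrow> (real ^ 'd) set" where "B N = grid_box (Suc N) (\<lceil>real (Suc N) * r\<rceil> + 1)" for N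
  define H where "H N z = (if z \<in> degenerate then 0 else
      \<Sum>q\<in>B N. if \<exists>x\<in>minimizers z. grid_round (Suc N) x = q then w z q else 0)" for N z
  show "H N \<in> borel_measurable M" for N
  proof -
    have [measurable]: "Measurable.pred M (\<lambda>z. \<exists>x\<in>minimizers z. grid_round (Suc N) x = q)" for q
      using measurable_ex_minimizer_in_cell[of "Suc N" q] by (simp add: pred_def)
    show ?thesis unfolding H_def w_def by measurable
  qed
  fix z assume z: "z \<in> space M"
  show "(\<lambda>N. H N z) \<longlonglongrightarrow> (if z \<in> degenerate then 0
      else \<Sum>x\<in>minimizers z. gibbs_weight (\<lambda>x. f x z) x * h x)"
  proof (cases "z \<in> degenerate")
    case False
    then have fin: "finite (minimizers z)" using z finite_minimizers by blast
    have lim: "(\<lambda>N. grid_round (Suc N) x) \<longlonglongrightarrow> x" for x :: "real ^ 'd"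
      using tendsto_grid_round[THEN LIMSEQ_Suc] .
    have "\<forall>\<^sub>F N in sequentially. inj_on (grid_round (Suc N)) (minimizers z)"
    proof -
      have "\<forall>\<^sub>F N in sequentially. grid_round (Suc N) x = grid_round (Suc N) y \<longrightarrow> x = y"
        for x y :: "real ^ 'd"
      proof (cases "x = y")
        case False
        then have "\<forall>\<^sub>F N in sequentially. grid_round (Suc N) x - grid_round (Suc N) y \<noteq> 0"
          by (intro tendsto_imp_eventually_ne[OF tendsto_diff[OF lim lim]]) auto
        then show ?thesis by eventually_elim simp
      qed simp
      then have "\<forall>\<^sub>F N in sequentially. \<forall>x\<in>minimizers z. \<forall>y\<in>minimizers z.
          grid_round (Suc N) x = grid_round (Suc N) y \<longrightarrow> x = y"
        using fin by (simp add: eventually_ball_finite_distrib)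
      then show ?thesis by (simp add: inj_on_def)
    qed
    then have ev: "\<forall>\<^sub>F N in sequentially. H N z = (\<Sum>x\<in>minimizers z. w z (grid_round (Suc N) x))"
    proof eventually_elim
      case (elim N)
      have "grid_round (Suc N) ` minimizers z \<subseteq> B N"
      proof (intro image_subsetI)
        fix x assume "x \<in> minimizers z"
        then have "norm x \<le> r" using argmin_bounded[OF z] by auto
        then show "grid_round (Suc N) x \<in> B N"
          unfolding B_def using r_nonneg by (rule grid_round_in_box)
      qed
      moreover have "finite (B N)" unfolding B_def by (rule finite_grid_box)
      ultimately have "H N z = (\<Sum>q\<in>grid_round (Suc N) ` minimizers z. w z q)"
        using False unfolding H_def by (auto intro!: sum.mono_neutral_cong_right)
      then show ?case by (simp add: sum.reindex[OF elim])
    qed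
    have "(\<lambda>N. w z (grid_round (Suc N) x)) \<longlonglongrightarrow> w z x" if x: "x \<in> minimizers z" for x
    proof -
      have "det_hess z x \<noteq> 0" using False x z by (auto simp: degenerate_def)
      then show ?thesis
        unfolding w_def gibbs_weight_def
        by (intro tendsto_intros continuous_on_tendsto_compose[OF continuous_on_det_hessian lim]
            continuous_on_tendsto_compose[OF h lim] f_smooth z) auto
    qed
    then have "(\<lambda>N. \<Sum>x\<in>minimizers z. w z (grid_round (Suc N) x)) \<longlonglongrightarrow> (\<Sum>x\<in>minimizers z. w z x)"
      by (rule tendsto_sum)
    then have "(\<lambda>N. H N z) \<longlonglongrightarrow> (\<Sum>x\<in>minimizers z. w z x)"
      using ev by (simp cong: tendsto_cong)
    with False show ?thesis by (simp add: w_def)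
  qed (simp add: H_def)
qed

end

section \<open>Deviation of a sample mean\<close>

lemma prob_space_sample_measure: "prob_space \<mu> \<Longrightarrow> prob_space (sample_measure \<mu> n)"
  unfolding sample_measure_def by (intro prob_space_PiM)

lemma measurable_sample_component:
  assumes "h \<in> borel_measurable \<mu>" "i \<in> {1..n}"
  shows "(\<lambda>z. h (z i)) \<in> borel_measurable (sample_measure \<mu> n)"
  unfolding sample_measure_def
  using assms by (intro measurable_compose[OF measurable_component_singleton])

lemma (in prob_space) expectation_abs_le_sqrt:
  fixes X :: "'a \<Rightarrow> real"
  assumes "integrable M X" "integrable M (\<lambda>x. (X x)\<^sup>2)"
  shows "expectation (\<lambda>x. \<bar>X x\<bar>) \<le> sqrt (expectation (\<lambda>x. (X x)\<^sup>2))"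
proof (rule real_le_rsqrt)
  have "0 \<le> variance (\<lambda>x. \<bar>X x\<bar>)" by (rule variance_positive)
  also have "\<dots> = expectation (\<lambda>x. (X x)\<^sup>2) - (expectation (\<lambda>x. \<bar>X x\<bar>))\<^sup>2"
    using assms by (subst variance_eq) auto
  finally show "(expectation (\<lambda>x. \<bar>X x\<bar>))\<^sup>2 \<le> expectation (\<lambda>x. (X x)\<^sup>2)" by simp
qed

text \<open>
  Centred copies at different coordinates are uncorrelated, so the second moment of the deviation is
  at most \<open>(2b)\<^sup>2 / n\<close>, which bounds the first moment by \<open>2b / sqrt n\<close>.
\<close>

lemma sample_mean_deviation:
  fixes h :: "'z \<Rightarrow> real"
  assumes "prob_space \<mu>" and h [measurable]: "h \<in> borel_measurable \<mu>"
    and bound: "\<And>z. z \<in> space \<mu> \<Longrightarrow> \<bar>h z\<bar> \<le> b" and n: "n \<ge> 1"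
  shows "(\<integral>z. \<bar>1 / real n * (\<Sum>i=1..n. h (z i)) - (\<integral>z. h z \<partial>\<mu>)\<bar> \<partial>sample_measure \<mu> n)
    \<le> 2 * b / sqrt (real n)"
proof -
  interpret \<mu>: prob_space \<mu> by fact
  interpret S: prob_space "sample_measure \<mu> n" using assms(1) by (rule prob_space_sample_measure)
  interpret product_sigma_finite "\<lambda>_::nat. \<mu>" ..
  have b: "b \<ge> 0" using bound \<mu>.not_empty by fastforce
  define e where "e = (\<integral>z. h z \<partial>\<mu>)"
  define k where "k z = h z - e" for z
  have k_meas [measurable]: "k \<in> borel_measurable \<mu>" unfolding k_def by measurable
  have int_h: "integrable \<mu> h"
    using bound by (intro \<mu>.integrable_const_bound[where B = b]) auto
  have e: "\<bar>e\<bar> \<le> b"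
  proof -
    have "\<bar>e\<bar> \<le> (\<integral>z. \<bar>h z\<bar> \<partial>\<mu>)" unfolding e_def by (rule integral_abs_bound)
    also have "\<dots> \<le> (\<integral>z. b \<partial>\<mu>)" using int_h bound by (intro integral_mono) auto
    finally show ?thesis by (simp add: \<mu>.prob_space)
  qed
  have k: "\<bar>k z\<bar> \<le> 2 * b" if "z \<in> space \<mu>" for z
    using bound[OF that] e unfolding k_def by linarith
  have int_k: "integrable \<mu> k" unfolding k_def using int_h by auto
  have Ek: "(\<integral>z. k z \<partial>\<mu>) = 0" unfolding k_def e_def using int_h by (simp add: \<mu>.prob_space)
  have sp: "z i \<in> space \<mu>" if "z \<in> space (sample_measure \<mu> n)" "i \<in> {1..n}" for z i
    using that by (auto simp: sample_measure_def space_PiM)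
  have [measurable]: "(\<lambda>z. k (z i)) \<in> borel_measurable (sample_measure \<mu> n)" if "i \<in> {1..n}" for i
    using that by (intro measurable_sample_component k_meas)
  have kk: "\<bar>k (z i) * k (z j)\<bar> \<le> (2 * b)\<^sup>2"
    if "z \<in> space (sample_measure \<mu> n)" "i \<in> {1..n}" "j \<in> {1..n}" for z i j
    unfolding abs_mult power2_eq_square using that b by (intro mult_mono k sp) auto
  have int: "integrable (sample_measure \<mu> n) (\<lambda>z. k (z i) * k (z j))"
    if "i \<in> {1..n}" "j \<in> {1..n}" for i j
    using that kk by (intro S.integrable_const_bound[where B = "(2 * b)\<^sup>2"] AE_I2
        borel_measurable_times) auto
  have cov: "(\<integral>z. k (z i) * k (z j) \<partial>sample_measure \<mu> n) \<le> (if i = j then (2 * b)\<^sup>2 else 0)"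
    if ij: "i \<in> {1..n}" "j \<in> {1..n}" for i j
  proof (cases "i = j")
    case True
    have "(\<integral>z. k (z i) * k (z j) \<partial>sample_measure \<mu> n) \<le> (\<integral>z. (2 * b)\<^sup>2 \<partial>sample_measure \<mu> n)"
      using ij kk by (intro integral_mono int) (auto simp: abs_le_iff)
    then show ?thesis using True by (simp add: S.prob_space)
  next
    case False
    \<comment> \<open>With factor \<open>1\<close> at the other coordinates, the mixed moment is an integral of a full product.\<close>
    define F where "F l = (if l = i \<or> l = j then k else (\<lambda>_. 1))" for l
    have "(\<Prod>l\<in>{1..n}. F l (z l)) = k (z i) * k (z j)" for z
    proof -
      have "(\<Prod>l\<in>{1..n}. F l (z l)) = (\<Prod>l\<in>{i, j}. F l (z l))"
        using ij by (intro prod.mono_neutral_right) (auto simp: F_def)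
      then show ?thesis using False by (simp add: F_def)
    qed
    then have "(\<integral>z. k (z i) * k (z j) \<partial>sample_measure \<mu> n) =
        (\<integral>z. (\<Prod>l\<in>{1..n}. F l (z l)) \<partial>sample_measure \<mu> n)" by simp
    also have "\<dots> = (\<Prod>l\<in>{1..n}. \<integral>z. F l z \<partial>\<mu>)"
      unfolding sample_measure_def
      by (rule product_integral_prod) (auto simp: F_def int_k)
    also have "\<dots> = 0"
      using ij by (intro prod_zero bexI[of _ i]) (auto simp: F_def Ek)
    finally show ?thesis using False by simp
  qed
  define X where "X z = 1 / real n * (\<Sum>i=1..n. h (z i)) - e" for z
  have X: "X z = (\<Sum>i=1..n. k (z i)) / real n" for z
    using n by (simp add: X_def k_def sum_subtractf diff_divide_distrib)
  have X2: "(X z)\<^sup>2 = (\<Sum>i=1..n. \<Sum>j=1..n. k (z i) * k (z j)) / (real n)\<^sup>2" for z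
    by (simp add: X power_divide power2_eq_square sum_product)
  have int_X: "integrable (sample_measure \<mu> n) X"
    unfolding X
  proof (intro integrable_divide_zero Bochner_Integration.integrable_sum)
    show "integrable (sample_measure \<mu> n) (\<lambda>z. k (z i))" if "i \<in> {1..n}" for i
      using that by (intro S.integrable_const_bound[where B = "2 * b"] AE_I2) (auto intro!: k sp[OF _ that])
  qed
  have int_X2: "integrable (sample_measure \<mu> n) (\<lambda>z. (X z)\<^sup>2)"
    unfolding X2 by (intro integrable_divide_zero Bochner_Integration.integrable_sum int)
  have "(\<integral>z. (X z)\<^sup>2 \<partial>sample_measure \<mu> n) =
      (\<Sum>i=1..n. \<Sum>j=1..n. \<integral>z. k (z i) * k (z j) \<partial>sample_measure \<mu> n) / (real n)\<^sup>2"
    unfolding X2 by (simp add: Bochner_Integration.integral_sum int del: atLeastAtMost_iff)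
  also have "\<dots> \<le> (\<Sum>i=1..n. \<Sum>j=1..n. if i = j then (2 * b)\<^sup>2 else 0) / (real n)\<^sup>2"
    by (intro divide_right_mono sum_mono cov) auto
  also have "\<dots> = (2 * b)\<^sup>2 / real n"
    using n by (simp add: power2_eq_square)
  finally have "(\<integral>z. (X z)\<^sup>2 \<partial>sample_measure \<mu> n) \<le> (2 * b)\<^sup>2 / real n" .
  then have "sqrt (\<integral>z. (X z)\<^sup>2 \<partial>sample_measure \<mu> n) \<le> 2 * b / sqrt (real n)"
    using b by (metis abs_of_nonneg mult_nonneg_nonneg real_sqrt_abs real_sqrt_divide
        real_sqrt_le_iff zero_le_numeral)
  with S.expectation_abs_le_sqrt[OF int_X int_X2] show ?thesis
    unfolding X_def e_def by linarith
qed

section \<open>Dissipative losses\<close>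

lemma lipschitz_of_grad_bound:
  fixes f :: "real ^ 'd \<Rightarrow> real"
  assumes d: "\<And>x. f differentiable (at x)" and L: "\<And>x. norm x \<le> \<rho> \<Longrightarrow> norm (grad f x) \<le> L"
    and xy: "norm x \<le> \<rho>" "norm y \<le> \<rho>"
  shows "\<bar>f x - f y\<bar> \<le> L * norm (x - y)"
proof -
  have "norm (f x - f y) \<le> L * norm (x - y)"
  proof (rule differentiable_bound[where S = "cball 0 \<rho>" and f = f and x = x and y = y and f' = "\<lambda>x v. grad f x \<bullet> v"])
    fix w :: "real ^ 'd" assume w: "w \<in> cball 0 \<rho>"
    show "(f has_derivative (\<lambda>v. grad f w \<bullet> v)) (at w within cball 0 \<rho>)"
      by (rule has_derivative_at_withinI[OF grad_has_derivative[OF d]])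
    have "norm (grad f w) \<le> L" using L[of w] w by simp
    then have "L \<ge> 0" using norm_ge_zero[of "grad f w"] by linarith
    then show "onorm (\<lambda>v. grad f w \<bullet> v) \<le> L"
    proof (rule onorm_bound)
      fix v
      have "norm (grad f w \<bullet> v) \<le> norm (grad f w) * norm v"
        by (simp add: Cauchy_Schwarz_ineq2)
      also have "\<dots> \<le> L * norm v" using L[of w] w by (intro mult_right_mono) auto
      finally show "norm (grad f w \<bullet> v) \<le> L * norm v" .
    qed
  qed (use xy in auto)
  then show ?thesis by simp
qed

locale dissipative_risk =
  fixes u :: "real ^ 'd \<Rightarrow> 'z::topological_space \<Rightarrow> real" and \<mu> :: "'z measure"
    and A B M m c :: real
  assumes prob_space: "prob_space \<mu>" and sets_eq: "sets \<mu> = sets borel"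
    and u_nonneg: "\<And>x z. u x z \<ge> 0"
    and u_smooth: "\<And>z. smooth (\<lambda>x. u x z)"
    and u0_le: "\<And>z. \<bar>u 0 z\<bar> \<le> A" and grad0_le: "\<And>z. norm (grad (\<lambda>x. u x z) 0) \<le> B"
    and M_nonneg: "M \<ge> 0"
    and grad_Lipschitz: "\<And>x y z.
      norm (grad (\<lambda>x. u x z) x - grad (\<lambda>x. u x z) y) \<le> M * norm (x - y)"
    and m_pos: "m > 0" and c_nonneg: "c \<ge> 0"
    and dissipative: "\<And>x z. grad (\<lambda>x. u x z) x \<bullet> x \<ge> m * (norm x)\<^sup>2 - c"
    and u_continuous: "continuous_on UNIV (\<lambda>(x, z). u x z)"
begin

sublocale \<mu>: prob_space \<mu> by (rule prob_space)

text \<open>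
  Beyond the radius \<open>sqrt (c / m)\<close> dissipativity makes the radial derivative of every loss positive.
  The summand \<open>1\<close> makes this hold from the sphere itself on and keeps the radius positive when \<open>c = 0\<close>.
\<close>

definition radius :: real where "radius = sqrt (c / m) + 1"

lemma radius_pos: "radius > 0"
  using m_pos c_nonneg by (simp add: radius_def add_nonneg_pos)

lemma B_nonneg: "B \<ge> 0"
  using grad0_le[of undefined] norm_ge_zero[of "grad (\<lambda>x. u x undefined) 0"] by linarith

lemma u_differentiable: "(\<lambda>x. u x z) differentiable (at x)"
  by (rule smooth_imp_differentiable[OF u_smooth])

lemma u_radially_increasing:
  assumes "norm y > radius"
  shows "u ((radius / norm y) *\<^sub>R y) z < u y z"
proof -
  define e where "e = (1 / norm y) *\<^sub>R y"
  have y: "norm y > 0" using assms radius_pos by linarith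
  then have e: "norm e = 1" by (simp add: e_def)
  have "u (radius *\<^sub>R e) z < u (norm y *\<^sub>R e) z"
  proof (rule DERIV_pos_imp_increasing[where f = "\<lambda>t. u (t *\<^sub>R e) z"])
    fix t assume t: "radius \<le> t" "t \<le> norm y"
    then have t0: "t > 0" using radius_pos by linarith
    have "((\<lambda>t. u (t *\<^sub>R e) z) has_derivative (\<lambda>h. grad (\<lambda>x. u x z) (t *\<^sub>R e) \<bullet> (h *\<^sub>R e))) (at t)"
      by (rule has_derivative_compose[where g = "\<lambda>x. u x z"])
         (auto intro!: derivative_eq_intros grad_has_derivative u_differentiable)
    then have "((\<lambda>t. u (t *\<^sub>R e) z) has_field_derivative grad (\<lambda>x. u x z) (t *\<^sub>R e) \<bullet> e) (at t)"
      by (simp add: has_field_derivative_def mult_commute_abs)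
    moreover have "grad (\<lambda>x. u x z) (t *\<^sub>R e) \<bullet> e > 0"
    proof -
      have "sqrt (c / m) < t" using t(1) by (simp add: radius_def)
      moreover have "c / m \<ge> 0" using m_pos c_nonneg by simp
      ultimately have "(sqrt (c / m))\<^sup>2 < t\<^sup>2" by (intro power_strict_mono) auto
      then have "c / m < t\<^sup>2" using \<open>c / m \<ge> 0\<close> by simp
      then have "0 < m * t\<^sup>2 - c" using m_pos by (simp add: field_simps)
      also have "\<dots> \<le> grad (\<lambda>x. u x z) (t *\<^sub>R e) \<bullet> (t *\<^sub>R e)"
        using dissipative[of "t *\<^sub>R e" z] e by simp
      also have "\<dots> = t * (grad (\<lambda>x. u x z) (t *\<^sub>R e) \<bullet> e)" by simp
      finally show ?thesis using t0 by (simp add: zero_less_mult_iff)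
    qed
    ultimately show "\<exists>D. ((\<lambda>t. u (t *\<^sub>R e) z) has_field_derivative D) (at t) \<and> D > 0" by blast
  qed (use assms in auto)
  then show ?thesis using y by (simp add: e_def)
qed

text \<open>
  The retraction onto the ball increases none of the losses, hence neither the empirical nor
  the population risk: all minimization can be confined to the same compact ball.
\<close>

definition retract_ball :: "real ^ 'd \<Rightarrow> real ^ 'd" where
  "retract_ball y = (if norm y \<le> radius then y else (radius / norm y) *\<^sub>R y)"

lemma norm_retract_ball: "norm (retract_ball y) \<le> radius"
  using radius_pos by (simp add: retract_ball_def)

lemma u_retract_ball: "u (retract_ball y) z \<le> u y z"
  using u_radially_increasing[of y z] by (cases "norm y \<le> radius") (simp_all add: retract_ball_def)

lemma u_Lipschitz:
  assumes "norm x \<le> \<rho>" "norm y \<le> \<rho>"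
  shows "\<bar>u x z - u y z\<bar> \<le> (B + M * \<rho>) * norm (x - y)"
proof (rule lipschitz_of_grad_bound[OF u_differentiable _ assms])
  fix w :: "real ^ 'd" assume w: "norm w \<le> \<rho>"
  have "norm (grad (\<lambda>x. u x z) w) \<le> norm (grad (\<lambda>x. u x z) 0) + M * norm w"
    using grad_Lipschitz[of z w 0] norm_triangle_sub[of "grad (\<lambda>x. u x z) w" "grad (\<lambda>x. u x z) 0"]
    by simp
  with grad0_le[of z] mult_left_mono[OF w M_nonneg]
  show "norm (grad (\<lambda>x. u x z) w) \<le> B + M * \<rho>" by linarith
qed

lemma u_bounded:
  assumes "norm x \<le> \<rho>"
  shows "\<bar>u x z\<bar> \<le> A + (B + M * \<rho>) * \<rho>"
proof -
  have \<rho>: "\<rho> \<ge> 0" using assms norm_ge_zero[of x] by linarith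
  have "\<bar>u x z - u 0 z\<bar> \<le> (B + M * \<rho>) * norm x"
    using u_Lipschitz[of x \<rho> 0 z] assms \<rho> by simp
  also have "\<dots> \<le> (B + M * \<rho>) * \<rho>"
    using assms \<rho> B_nonneg M_nonneg by (intro mult_left_mono) auto
  finally show ?thesis using u0_le[of z] by linarith
qed

lemma u_measurable [measurable]: "u x \<in> borel_measurable \<mu>"
proof -
  have "continuous_on UNIV ((\<lambda>(x, z). u x z) \<circ> (\<lambda>z. (x, z)))"
    by (intro continuous_on_compose continuous_intros continuous_on_subset[OF u_continuous]) auto
  then have "continuous_on UNIV (u x)" by (simp add: o_def)
  then have "u x \<in> borel_measurable borel" by (rule borel_measurable_continuous_onI)
  then show ?thesis by (simp only: measurable_cong_sets[OF sets_eq refl])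
qed

lemma u_integrable: "integrable \<mu> (u x)"
  using u_bounded[of x "norm x"] by (intro \<mu>.integrable_const_bound) auto

lemma pop_risk_nonneg: "pop_risk \<mu> u x \<ge> 0"
  by (simp add: pop_risk_def u_nonneg)

lemma pop_risk_Lipschitz:
  assumes "norm x \<le> \<rho>" "norm y \<le> \<rho>"
  shows "\<bar>pop_risk \<mu> u x - pop_risk \<mu> u y\<bar> \<le> (B + M * \<rho>) * norm (x - y)"
proof -
  have "\<bar>pop_risk \<mu> u x - pop_risk \<mu> u y\<bar> = \<bar>\<integral>z. u x z - u y z \<partial>\<mu>\<bar>"
    by (simp add: pop_risk_def u_integrable)
  also have "\<dots> \<le> (\<integral>z. \<bar>u x z - u y z\<bar> \<partial>\<mu>)" by (rule integral_abs_bound)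
  also have "\<dots> \<le> (\<integral>z. (B + M * \<rho>) * norm (x - y) \<partial>\<mu>)"
    using u_Lipschitz[OF assms] by (intro integral_mono) (auto intro!: integrable_abs Bochner_Integration.integrable_diff u_integrable)
  finally show ?thesis by (simp add: \<mu>.prob_space)
qed

lemma pop_risk_continuous: "continuous_on UNIV (pop_risk \<mu> u)"
proof -
  have "isCont (pop_risk \<mu> u) x" for x
  proof -
    define L where "L = B + M * (norm x + 1)"
    show ?thesis
      unfolding isCont_def
    proof (rule metric_tendsto_imp_tendsto)
      show "((\<lambda>y. L * norm (y - x)) \<longlongrightarrow> 0) (at x)"
        by (auto intro!: tendsto_eq_intros)
      have "\<forall>\<^sub>F y in at x. dist y x < 1"
        unfolding eventually_at by (intro exI[of _ 1]) auto
      then show "\<forall>\<^sub>F y in at x. dist (pop_risk \<mu> u y) (pop_risk \<mu> u x) \<le> dist (L * norm (y - x)) 0"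
      proof eventually_elim
        case (elim y)
        have "norm y \<le> norm x + 1"
          using elim norm_triangle_sub[of y x] by (simp add: dist_norm)
        from pop_risk_Lipschitz[OF this, of x] show ?case
          by (simp add: L_def dist_real_def)
      qed
    qed
  qed
  then show ?thesis by (simp add: continuous_on_eq_continuous_at)
qed

lemma pop_risk_bounded: "norm x \<le> \<rho> \<Longrightarrow> pop_risk \<mu> u x \<le> A + (B + M * \<rho>) * \<rho>"
  unfolding pop_risk_def using u_bounded[of x \<rho>]
  by (intro \<mu>.integral_le_const u_integrable AE_I2) (auto simp: abs_le_iff)

lemma pop_risk_retract_ball: "pop_risk \<mu> u (retract_ball y) \<le> pop_risk \<mu> u y"
  unfolding pop_risk_def by (intro integral_mono u_integrable u_retract_ball)

lemma emp_risk_measurable [measurable]: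
  "(\<lambda>z. emp_risk u n z x) \<in> borel_measurable (sample_measure \<mu> n)"
proof -
  have "(\<lambda>z. u x (z i)) \<in> borel_measurable (sample_measure \<mu> n)" if "i \<in> {1..n}" for i
    using u_measurable that by (rule measurable_sample_component)
  then show ?thesis
    unfolding emp_risk_def by (intro borel_measurable_times borel_measurable_sum borel_measurable_const)
qed

lemma emp_risk_Lipschitz:
  assumes "norm x \<le> \<rho>" "norm y \<le> \<rho>" "n \<ge> 1"
  shows "\<bar>emp_risk u n z x - emp_risk u n z y\<bar> \<le> (B + M * \<rho>) * norm (x - y)"
proof -
  have "\<bar>emp_risk u n z x - emp_risk u n z y\<bar> = 1 / real n * \<bar>\<Sum>i=1..n. u x (z i) - u y (z i)\<bar>"
    unfolding emp_risk_def right_diff_distrib[symmetric] sum_subtractf[symmetric] abs_mult by simp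
  also have "\<dots> \<le> 1 / real n * (\<Sum>i=1..n. \<bar>u x (z i) - u y (z i)\<bar>)"
    by (intro mult_left_mono sum_abs) auto
  also have "\<dots> \<le> 1 / real n * (\<Sum>i=1..n. (B + M * \<rho>) * norm (x - y))"
    using assms by (intro mult_left_mono sum_mono u_Lipschitz) auto
  also have "\<dots> = (B + M * \<rho>) * norm (x - y)" using \<open>n \<ge> 1\<close> by simp
  finally show ?thesis .
qed

lemma emp_risk_retract_ball: "emp_risk u n z (retract_ball y) \<le> emp_risk u n z y"
  unfolding emp_risk_def by (intro mult_left_mono sum_mono u_retract_ball) auto

lemma argmin_emp_risk_bounded:
  assumes "n \<ge> 1"
  shows "argmin_set (emp_risk u n z) \<subseteq> cball 0 radius"
proof
  fix x assume x: "x \<in> argmin_set (emp_risk u n z)"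
  show "x \<in> cball 0 radius"
  proof (rule ccontr)
    assume "x \<notin> cball 0 radius"
    then have "emp_risk u n z ((radius / norm x) *\<^sub>R x) < emp_risk u n z x"
      using assms unfolding emp_risk_def
      by (intro mult_strict_left_mono sum_strict_mono u_radially_increasing) auto
    with x show False unfolding argmin_set_iff by (meson not_le)
  qed
qed

lemma argmin_emp_risk_nonempty: "argmin_set (emp_risk u n z) \<noteq> {}"
proof -
  have "continuous_on (cball 0 radius) (emp_risk u n z)"
    by (rule continuous_on_subset[OF smooth_imp_continuous[OF smooth_emp_risk[OF u_smooth]] subset_UNIV])
  moreover have "cball (0 :: real ^ 'd) radius \<noteq> {}" using radius_pos by simp
  ultimately obtain x where x: "\<And>y. y \<in> cball 0 radius \<Longrightarrow> emp_risk u n z x \<le> emp_risk u n z y"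
    using continuous_attains_inf[OF compact_cball] by metis
  have "emp_risk u n z x \<le> emp_risk u n z y" for y
    using x[of "retract_ball y"] emp_risk_retract_ball[of n z y] norm_retract_ball[of y] by simp
  then have "x \<in> argmin_set (emp_risk u n z)" by (simp add: argmin_set_iff)
  then show ?thesis by blast
qed

lemma random_landscape_emp_risk:
  assumes "n \<ge> 1"
  shows "random_landscape (sample_measure \<mu> n) (\<lambda>x z. emp_risk u n z x) radius"
proof
  show "argmin_set (\<lambda>x. emp_risk u n z x) \<noteq> {}" for z by (rule argmin_emp_risk_nonempty)
  show "argmin_set (\<lambda>x. emp_risk u n z x) \<subseteq> cball 0 radius" for z
    using assms by (rule argmin_emp_risk_bounded)
  show "smooth (\<lambda>x. emp_risk u n z x)" for z by (rule smooth_emp_risk[OF u_smooth])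
qed (use radius_pos in \<open>auto intro: less_imp_le\<close>)

end

section \<open>Uniform law of large numbers and excess risk\<close>

context dissipative_risk
begin

text \<open>
  Rounding to a grid of mesh at most \<open>1\<close> moves a point by at most \<open>d\<close>, so grid points near the ball of
  minimizers stay in the ball of radius \<open>net_radius\<close>, on which all losses are bounded and Lipschitz.
\<close>

definition net_radius :: real where "net_radius = radius + real CARD('d)"

definition lip_const :: real where "lip_const = B + M * net_radius"

definition risk_bound :: real where "risk_bound = A + lip_const * net_radius"

definition net :: "nat \<Rightarrow> (real ^ 'd) set" where
  "net N = grid_box N (\<lceil>real N * radius\<rceil> + 1) \<inter> cball 0 net_radius"

text \<open>
  A bound, uniform over the ball, for the deviation of the empirical from the population risk. The
  first summand pays for moving to the nearest grid point in both risks. The maximum over the net is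
  replaced by the sum so that the expectation can be taken term by term.
\<close>

definition discrepancy :: "nat \<Rightarrow> nat \<Rightarrow> (nat \<Rightarrow> 'z) \<Rightarrow> real" where
  "discrepancy N n z = 2 * lip_const * real CARD('d) / real N
     + (\<Sum>q\<in>net N. \<bar>emp_risk u n z q - pop_risk \<mu> u q\<bar>)"

lemma finite_net: "finite (net N)"
  unfolding net_def using finite_grid_box by blast

lemma net_radius_pos: "net_radius > 0"
  unfolding net_radius_def using radius_pos by (intro add_pos_nonneg) auto

lemma lip_const_nonneg: "lip_const \<ge> 0"
  unfolding lip_const_def using B_nonneg M_nonneg net_radius_pos by (intro add_nonneg_nonneg) auto

lemma risk_bound_nonneg: "risk_bound \<ge> 0"
  using u0_le[of undefined] lip_const_nonneg net_radius_pos
  unfolding risk_bound_def by (intro add_nonneg_nonneg) auto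

lemma card_net:
  assumes "N \<ge> 1"
  shows "real (card (net N)) \<le> ((2 * radius + 5) * real N) ^ CARD('d)"
proof -
  have "card (net N) \<le> card (grid_box N (\<lceil>real N * radius\<rceil> + 1) :: (real ^ 'd) set)"
    unfolding net_def by (intro card_mono finite_grid_box) auto
  also have "\<dots> \<le> nat (2 * (\<lceil>real N * radius\<rceil> + 1) + 1) ^ CARD('d)" by (rule card_grid_box)
  finally have "real (card (net N)) \<le> real (nat (2 * (\<lceil>real N * radius\<rceil> + 1) + 1)) ^ CARD('d)"
    by (metis of_nat_le_iff of_nat_power)
  also have "\<dots> \<le> ((2 * radius + 5) * real N) ^ CARD('d)"
  proof (rule power_mono)
    have "real N * radius \<ge> 0" using radius_pos by simp
    then have "\<lceil>real N * radius\<rceil> \<ge> 0" by linarith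
    then have "real (nat (2 * (\<lceil>real N * radius\<rceil> + 1) + 1))
        = 2 * real_of_int \<lceil>real N * radius\<rceil> + 3" by simp
    also have "\<dots> \<le> 2 * (real N * radius) + 5" by linarith
    also have "\<dots> \<le> 2 * (real N * radius) + 5 * real N" using assms by simp
    finally show "real (nat (2 * (\<lceil>real N * radius\<rceil> + 1) + 1)) \<le> (2 * radius + 5) * real N"
      by (simp add: algebra_simps)
  qed simp
  finally show ?thesis .
qed

lemma deviation_le_discrepancy:
  assumes x: "norm x \<le> radius" and N: "N \<ge> 1" and n: "n \<ge> 1"
  shows "\<bar>emp_risk u n z x - pop_risk \<mu> u x\<bar> \<le> discrepancy N n z"
proof -
  define q where "q = grid_round N x"
  have dq: "norm (x - q) \<le> real CARD('d) / real N"
    using dist_grid_round[OF N, of x] by (simp add: q_def dist_norm norm_minus_commute)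
  also have "\<dots> \<le> real CARD('d)" using N by (simp add: divide_le_eq mult_le_cancel_left1)
  finally have "norm (x - q) \<le> real CARD('d)" .
  with x have q': "norm q \<le> net_radius"
    using norm_triangle_ineq4[of x "x - q"] by (simp add: net_radius_def)
  have x': "norm x \<le> net_radius" using x by (simp add: net_radius_def)
  have "q \<in> net N"
    using grid_round_in_box[OF x, of N] q' radius_pos by (simp add: net_def q_def)
  then have "\<bar>emp_risk u n z q - pop_risk \<mu> u q\<bar> \<le> (\<Sum>q\<in>net N. \<bar>emp_risk u n z q - pop_risk \<mu> u q\<bar>)"
    by (intro member_le_sum finite_net) auto
  moreover have "\<bar>emp_risk u n z x - emp_risk u n z q\<bar> \<le> lip_const * norm (x - q)"
    unfolding lip_const_def by (intro emp_risk_Lipschitz x' q' n)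
  moreover have "\<bar>pop_risk \<mu> u x - pop_risk \<mu> u q\<bar> \<le> lip_const * norm (x - q)"
    unfolding lip_const_def by (intro pop_risk_Lipschitz x' q')
  moreover have "lip_const * norm (x - q) \<le> lip_const * real CARD('d) / real N"
    using mult_left_mono[OF dq lip_const_nonneg] by simp
  moreover have "2 * lip_const * real CARD('d) / real N = lip_const * real CARD('d) / real N + lip_const * real CARD('d) / real N"
    by simp
  ultimately show ?thesis unfolding discrepancy_def by linarith
qed

text \<open>
  The usual argument for empirical risk minimization: passing from population to empirical risk and
  back costs the uniform deviation twice. The comparison point must first be retracted to the ball,
  since the deviation is not controlled outside.
\<close>

lemma pop_risk_argmin_le:
  assumes x: "x \<in> argmin_set (emp_risk u n z)" and N: "N \<ge> 1" and n: "n \<ge> 1"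
  shows "pop_risk \<mu> u x \<le> pop_risk \<mu> u y + 2 * discrepancy N n z"
proof -
  have "norm x \<le> radius" using argmin_emp_risk_bounded[OF n, of z] x by auto
  from deviation_le_discrepancy[OF this N n, of z]
  have "pop_risk \<mu> u x \<le> emp_risk u n z x + discrepancy N n z" by linarith
  also have "emp_risk u n z x \<le> emp_risk u n z (retract_ball y)" using x by (simp add: argmin_set_iff)
  also have "emp_risk u n z (retract_ball y) \<le> pop_risk \<mu> u (retract_ball y) + discrepancy N n z"
    using deviation_le_discrepancy[OF norm_retract_ball N n, of z y] by linarith
  also have "pop_risk \<mu> u (retract_ball y) \<le> pop_risk \<mu> u y" by (rule pop_risk_retract_ball)
  finally show ?thesis by simp
qed

lemma integrable_deviation:
  assumes n: "n \<ge> 1" and q: "norm q \<le> net_radius"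
  shows "integrable (sample_measure \<mu> n) (\<lambda>z. \<bar>emp_risk u n z q - pop_risk \<mu> u q\<bar>)"
proof -
  interpret S: prob_space "sample_measure \<mu> n" by (rule prob_space_sample_measure[OF prob_space])
  have "\<bar>emp_risk u n z q\<bar> \<le> risk_bound" for z
  proof -
    have "\<bar>emp_risk u n z q\<bar> \<le> 1 / real n * (\<Sum>i=1..n. \<bar>u q (z i)\<bar>)"
      unfolding emp_risk_def abs_mult by (simp add: divide_right_mono)
    also have "\<dots> \<le> 1 / real n * (\<Sum>i=1..n. risk_bound)"
      unfolding risk_bound_def lip_const_def by (intro mult_left_mono sum_mono u_bounded q) auto
    also have "\<dots> = risk_bound" using n by simp
    finally show ?thesis .
  qed
  then have "integrable (sample_measure \<mu> n) (\<lambda>z. emp_risk u n z q)"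
    by (intro S.integrable_const_bound[where B = risk_bound]) auto
  then show ?thesis by (intro integrable_abs Bochner_Integration.integrable_diff) auto
qed

lemma integrable_discrepancy:
  assumes "n \<ge> 1"
  shows "integrable (sample_measure \<mu> n) (discrepancy N n)"
proof -
  interpret S: prob_space "sample_measure \<mu> n" by (rule prob_space_sample_measure[OF prob_space])
  show ?thesis
    unfolding discrepancy_def[abs_def]
    by (intro Bochner_Integration.integrable_add Bochner_Integration.integrable_sum
        integrable_deviation assms S.integrable_const) (auto simp: net_def)
qed

lemma expected_discrepancy_le:
  assumes n: "n \<ge> 1" and N: "N \<ge> 1"
  shows "(\<integral>z. discrepancy N n z \<partial>sample_measure \<mu> n)
    \<le> 2 * lip_const * real CARD('d) / real N
      + ((2 * radius + 5) * real N) ^ CARD('d) * (2 * risk_bound / sqrt (real n))"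
proof -
  interpret S: prob_space "sample_measure \<mu> n" by (rule prob_space_sample_measure[OF prob_space])
  have "(\<integral>z. discrepancy N n z \<partial>sample_measure \<mu> n) = 2 * lip_const * real CARD('d) / real N
      + (\<Sum>q\<in>net N. \<integral>z. \<bar>emp_risk u n z q - pop_risk \<mu> u q\<bar> \<partial>sample_measure \<mu> n)"
    unfolding discrepancy_def
    by (subst Bochner_Integration.integral_add)
      (auto simp: net_def S.prob_space intro!: integrable_deviation[OF n]
        Bochner_Integration.integral_sum Bochner_Integration.integrable_sum)
  also have "(\<Sum>q\<in>net N. \<integral>z. \<bar>emp_risk u n z q - pop_risk \<mu> u q\<bar> \<partial>sample_measure \<mu> n)
      \<le> (\<Sum>q\<in>net N. 2 * risk_bound / sqrt (real n))"
  proof (rule sum_mono)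
    fix q assume "q \<in> net N"
    then have q: "norm q \<le> net_radius" by (simp add: net_def)
    show "(\<integral>z. \<bar>emp_risk u n z q - pop_risk \<mu> u q\<bar> \<partial>sample_measure \<mu> n) \<le> 2 * risk_bound / sqrt (real n)"
      unfolding emp_risk_def pop_risk_def
    proof (rule sample_mean_deviation[OF prob_space u_measurable _ n])
      show "\<bar>u q z\<bar> \<le> risk_bound" for z unfolding risk_bound_def lip_const_def by (rule u_bounded[OF q])
    qed
  qed
  also have "\<dots> = real (card (net N)) * (2 * risk_bound / sqrt (real n))" by simp
  also have "\<dots> \<le> ((2 * radius + 5) * real N) ^ CARD('d) * (2 * risk_bound / sqrt (real n))"
    using risk_bound_nonneg by (intro mult_right_mono card_net N) auto
  finally show ?thesis by simp
qed

end

locale nondegenerate_risk = dissipative_risk u \<mu> A B M m c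
  for u :: "real ^ 'd \<Rightarrow> 'z::topological_space \<Rightarrow> real" and \<mu> A B M m c +
  assumes sigma_star_finite: "\<And>n. n \<ge> 1 \<Longrightarrow>
    (\<integral>\<^sup>+ z. sigma_star 1 (emp_risk u n z) \<partial>sample_measure \<mu> n) < \<infinity>"
begin

text \<open>
  For almost every sample the kernel averages \<^term>\<open>pop_risk \<mu> u\<close> over empirical minimizers only, and
  each of these is nearly optimal for the population risk. Integrating the pointwise bound over the
  sample gives the claim; the lower bound holds because the kernel has mass \<open>1\<close>.
\<close>

lemma limit_risk_bounds:
  assumes n: "n \<ge> 1" and N: "N \<ge> 1"
  shows "(INF x. pop_risk \<mu> u x) \<le> limit_risk \<mu> u n"
    and "limit_risk \<mu> u n \<le> (INF x. pop_risk \<mu> u x)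
      + 2 * (\<integral>z. discrepancy N n z \<partial>sample_measure \<mu> n)"
proof -
  let ?S = "sample_measure \<mu> n" and ?U = "pop_risk \<mu> u"
  define Ustar where "Ustar = (INF x. ?U x)"
  interpret S: prob_space ?S by (rule prob_space_sample_measure[OF prob_space])
  interpret RL: random_landscape ?S "\<lambda>x z. emp_risk u n z x" radius
    using n by (rule random_landscape_emp_risk)
  define F where "F z = (\<integral>x. ?U x \<partial>limit_kernel u n z)" for z
  have bdd: "bdd_below (range ?U)" using pop_risk_nonneg by (intro bdd_belowI[of _ 0]) auto
  have Ustar_le: "Ustar \<le> ?U x" for x unfolding Ustar_def using bdd by (intro cINF_lower) auto
  have U_meas: "?U \<in> borel_measurable borel"
    by (rule borel_measurable_continuous_onI[OF pop_risk_continuous])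

  have F_deg: "F z = 0" if "z \<in> RL.degenerate" for z
  proof -
    from that obtain x where "x \<in> argmin_set (emp_risk u n z)" "det (hessian (emp_risk u n z) x) = 0"
      by (auto simp: RL.degenerate_def)
    then show ?thesis unfolding F_def by (simp add: limit_kernel_degenerate)
  qed
  have nd: "finite (argmin_set (emp_risk u n z))"
    "\<And>x. x \<in> argmin_set (emp_risk u n z) \<Longrightarrow> det (hessian (emp_risk u n z) x) \<noteq> 0"
    if "z \<in> space ?S - RL.degenerate" for z
    using RL.finite_minimizers[OF that] that by (auto simp: RL.degenerate_def)
  have F_eq: "F z = (\<Sum>x\<in>argmin_set (emp_risk u n z). gibbs_weight (emp_risk u n z) x * ?U x) /
      (\<Sum>x\<in>argmin_set (emp_risk u n z). gibbs_weight (emp_risk u n z) x)"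
    if "z \<in> space ?S - RL.degenerate" for z
    unfolding F_def by (intro integral_limit_kernel nd[OF that] argmin_emp_risk_nonempty U_meas)
  have F_meas: "F \<in> borel_measurable ?S"
  proof -
    let ?G = "\<lambda>h z. if z \<in> RL.degenerate then 0
      else \<Sum>x\<in>argmin_set (emp_risk u n z). gibbs_weight (emp_risk u n z) x * h x :: real"
    \<comment> \<open>On degenerate samples both sums are set to \<open>0\<close>, and \<open>0 / 0 = 0\<close> agrees with the zero kernel.\<close>
    have F: "F z = ?G ?U z / ?G (\<lambda>_. 1) z" if "z \<in> space ?S" for z
    proof (cases "z \<in> RL.degenerate")
      case False
      with that have "z \<in> space ?S - RL.degenerate" by simp
      from F_eq[OF this] False show ?thesis by simp
    qed (simp add: F_deg)
    have "(\<lambda>z. ?G ?U z / ?G (\<lambda>_. 1) z) \<in> borel_measurable ?S"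
      by (intro borel_measurable_divide RL.measurable_sum_minimizers pop_risk_continuous
          continuous_on_const)
    then show ?thesis
      by (subst measurable_cong[where g = "\<lambda>z. ?G ?U z / ?G (\<lambda>_. 1) z"]) (rule F)
  qed

  \<comment> \<open>A weighted average lies between any bounds for the averaged values.\<close>
  have avg: "lo \<le> F z \<and> F z \<le> hi"
    if z: "z \<in> space ?S - RL.degenerate"
      and b: "\<And>x. x \<in> argmin_set (emp_risk u n z) \<Longrightarrow> lo \<le> ?U x \<and> ?U x \<le> hi" for z lo hi
  proof -
    let ?C = "argmin_set (emp_risk u n z)" and ?w = "gibbs_weight (emp_risk u n z)"
    have W: "(\<Sum>x\<in>?C. ?w x) > 0"
      using nd[OF z] argmin_emp_risk_nonempty by (intro sum_pos gibbs_weight_pos) auto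
    have "lo * (\<Sum>x\<in>?C. ?w x) \<le> (\<Sum>x\<in>?C. ?w x * ?U x)"
      unfolding sum_distrib_left mult.commute[of lo] using b gibbs_weight_nonneg
      by (intro sum_mono mult_left_mono) auto
    moreover have "(\<Sum>x\<in>?C. ?w x * ?U x) \<le> hi * (\<Sum>x\<in>?C. ?w x)"
      unfolding sum_distrib_left mult.commute[of hi] using b gibbs_weight_nonneg
      by (intro sum_mono mult_left_mono) auto
    ultimately show ?thesis
      unfolding F_eq[OF z] using W by (simp add: pos_le_divide_eq pos_divide_le_eq)
  qed

  \<comment> \<open>On a degenerate sample \<^const>\<open>sigma_star\<close> is infinite, so its integrability makes these null.\<close>
  have "emeasure ?S RL.degenerate = 0"
  proof (rule ccontr)
    assume *: "emeasure ?S RL.degenerate \<noteq> 0"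
    have "\<infinity> = \<infinity> * emeasure ?S RL.degenerate" using * by (simp add: ennreal_top_mult)
    also have "\<dots> = (\<integral>\<^sup>+z. \<infinity> * indicator RL.degenerate z \<partial>?S)"
      by (rule nn_integral_cmult_indicator[OF RL.degenerate_measurable, symmetric])
    also have "\<dots> \<le> (\<integral>\<^sup>+z. sigma_star 1 (emp_risk u n z) \<partial>?S)"
    proof (rule nn_integral_mono)
      fix z
      show "\<infinity> * indicator RL.degenerate z \<le> sigma_star 1 (emp_risk u n z)"
      proof (cases "z \<in> RL.degenerate")
        case True
        then obtain x where "x \<in> argmin_set (emp_risk u n z)" "det (hessian (emp_risk u n z) x) = 0"
          by (auto simp: RL.degenerate_def)
        then have "sigma_star 1 (emp_risk u n z) = \<infinity>" by (intro sigma_star_degenerate[of 1 x]) auto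
        then show ?thesis by simp
      qed simp
    qed
    finally show False using sigma_star_finite[OF n] by simp
  qed
  then have "AE z in ?S. z \<notin> RL.degenerate"
    by (intro AE_not_in) (auto simp: null_sets_def)
  with AE_space have AE_nd: "AE z in ?S. z \<in> space ?S - RL.degenerate" by eventually_elim auto

  have lower: "Ustar \<le> F z" if "z \<in> space ?S - RL.degenerate" for z
  proof -
    have "?U x \<le> risk_bound" if "x \<in> argmin_set (emp_risk u n z)" for x
      using argmin_emp_risk_bounded[OF n, of z] that unfolding risk_bound_def lip_const_def
      by (intro pop_risk_bounded) (auto simp: net_radius_def)
    then have "Ustar \<le> F z \<and> F z \<le> risk_bound" by (intro avg[OF that] conjI Ustar_le)
    then show ?thesis ..
  qed
  have upper: "F z \<le> Ustar + 2 * discrepancy N n z" if "z \<in> space ?S - RL.degenerate" for z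
  proof -
    have "?U x \<le> Ustar + 2 * discrepancy N n z" if "x \<in> argmin_set (emp_risk u n z)" for x
    proof -
      have "?U x - 2 * discrepancy N n z \<le> Ustar"
        unfolding Ustar_def using pop_risk_argmin_le[OF that N n]
        by (intro cINF_greatest) (auto simp: algebra_simps)
      then show ?thesis by simp
    qed
    then have "Ustar \<le> F z \<and> F z \<le> Ustar + 2 * discrepancy N n z"
      by (intro avg[OF that] conjI Ustar_le)
    then show ?thesis ..
  qed

  have int_up: "integrable ?S (\<lambda>z. Ustar + 2 * discrepancy N n z)"
    by (intro Bochner_Integration.integrable_add integrable_mult_right integrable_discrepancy n
        S.integrable_const)
  have int_F: "integrable ?S F"
  proof (rule Bochner_Integration.integrable_bound[OF int_up F_meas])
    have Ustar: "Ustar \<ge> 0" unfolding Ustar_def using pop_risk_nonneg by (intro cINF_greatest) auto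
    show "AE z in ?S. norm (F z) \<le> norm (Ustar + 2 * discrepancy N n z)"
      using AE_nd
    proof eventually_elim
      case (elim z)
      show ?case using lower[OF elim] upper[OF elim] Ustar by simp
    qed
  qed
  have risk: "limit_risk \<mu> u n = (\<integral>z. F z \<partial>?S)" by (simp add: limit_risk_def F_def)
  have "(\<integral>z. Ustar \<partial>?S) \<le> (\<integral>z. F z \<partial>?S)"
    by (intro integral_mono_AE int_F S.integrable_const eventually_mono[OF AE_nd] lower)
  then show "(INF x. ?U x) \<le> limit_risk \<mu> u n"
    by (simp add: risk S.prob_space Ustar_def)
  have "(\<integral>z. F z \<partial>?S) \<le> (\<integral>z. Ustar + 2 * discrepancy N n z \<partial>?S)"
    by (intro integral_mono_AE int_F int_up eventually_mono[OF AE_nd] upper)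
  also have "\<dots> = Ustar + 2 * (\<integral>z. discrepancy N n z \<partial>?S)"
    using integrable_discrepancy[OF n, of N] by (simp add: S.prob_space)
  finally show "limit_risk \<mu> u n \<le> (INF x. ?U x) + 2 * (\<integral>z. discrepancy N n z \<partial>?S)"
    by (simp add: risk Ustar_def)
qed

end

section \<open>Rates\<close>

context nondegenerate_risk
begin

text \<open>
  A grid of mesh \<open>1/N\<close> costs \<open>O(1/N)\<close> in bias and \<open>O(N\<^sup>d / sqrt n)\<close> in fluctuation. With
  \<open>N \<approx> n\<close> to the power \<open>1 / (4d)\<close> the second term is of order \<open>n\<close> to the power \<open>- 1/4\<close>,
  no larger than the first.
\<close>

lemma limit_risk_polynomial_rate:
  "\<exists>K\<ge>0. \<forall>n\<ge>1.
    limit_risk \<mu> u n \<le> (INF x. pop_risk \<mu> u x) + K * real n powr (- 1 / (4 * real CARD('d)))"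
proof (intro exI conjI allI impI)
  define d where "d = CARD('d)"
  have d: "real d \<ge> 1" unfolding d_def by (simp add: Suc_leI)
  define \<gamma> where "\<gamma> = 1 / (4 * real d)"
  have \<gamma>: "0 < \<gamma>" "\<gamma> \<le> 1/4" "real d * \<gamma> = 1/4" using d by (simp_all add: \<gamma>_def field_simps)
  define K1 where "K1 = 2 * lip_const * real d"
  define K2 where "K2 = (2 * (2 * radius + 5)) ^ d * (2 * risk_bound)"
  have K: "K1 \<ge> 0" "K2 \<ge> 0"
    unfolding K1_def K2_def using lip_const_nonneg risk_bound_nonneg radius_pos by auto
  then show "2 * (K1 + K2) \<ge> 0" by simp
  fix n :: nat assume n: "n \<ge> 1"
  define N where "N = nat \<lceil>real n powr \<gamma>\<rceil>"
  have p: "real n powr \<gamma> \<ge> 1" using n \<gamma> by (simp add: ge_one_powr_ge_zero)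
  have N: "real n powr \<gamma> \<le> real N" "real N \<le> 2 * real n powr \<gamma>" "N \<ge> 1"
    using p unfolding N_def by linarith+
  have "2 * lip_const * real d / real N \<le> K1 * real n powr (- \<gamma>)"
  proof -
    have "K1 / real N \<le> K1 / real n powr \<gamma>" using K N n by (intro divide_left_mono mult_pos_pos) auto
    then show ?thesis by (simp add: K1_def powr_minus_divide)
  qed
  moreover have "((2 * radius + 5) * real N) ^ d * (2 * risk_bound / sqrt (real n)) \<le> K2 * real n powr (- \<gamma>)"
  proof -
    have "((2 * radius + 5) * real N) ^ d \<le> ((2 * radius + 5) * (2 * real n powr \<gamma>)) ^ d"
      using N radius_pos by (intro power_mono mult_left_mono) auto
    also have "\<dots> = (2 * (2 * radius + 5)) ^ d * (real n powr \<gamma>) ^ d"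
      by (simp only: power_mult_distrib) (simp only: ac_simps)
    also have "(real n powr \<gamma>) ^ d = real n powr (1/4)"
    proof -
      have "(real n powr \<gamma>) ^ d = (real n powr \<gamma>) powr real d"
        using n by (intro powr_realpow[symmetric]) simp
      then show ?thesis using \<gamma>(3) by (simp only: powr_powr mult.commute)
    qed
    finally have "((2 * radius + 5) * real N) ^ d * (2 * risk_bound / sqrt (real n))
        \<le> (2 * (2 * radius + 5)) ^ d * real n powr (1/4) * (2 * risk_bound / sqrt (real n))"
      using risk_bound_nonneg by (intro mult_right_mono) auto
    also have "\<dots> = K2 * (real n powr (1/4) / sqrt (real n))" by (simp add: K2_def)
    also have "real n powr (1/4) / sqrt (real n) = real n powr (- (1/4))"
    proof -
      have "real n powr (1/4) / sqrt (real n) = real n powr (1/4) / real n powr (1/2)"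
        by (simp only: powr_half_sqrt of_nat_0_le_iff)
      also have "\<dots> = real n powr (1/4 - 1/2)" by (simp only: powr_diff)
      finally show ?thesis by simp
    qed
    also have "K2 * real n powr (- (1/4)) \<le> K2 * real n powr (- \<gamma>)"
      using K \<gamma> n by (intro mult_left_mono powr_mono) auto
    finally show ?thesis .
  qed
  ultimately have "(\<integral>z. discrepancy N n z \<partial>sample_measure \<mu> n) \<le> (K1 + K2) * real n powr (- \<gamma>)"
    using expected_discrepancy_le[OF n N(3)] by (simp add: d_def algebra_simps)
  with limit_risk_bounds(2)[OF n N(3)]
  have "limit_risk \<mu> u n \<le> (INF x. pop_risk \<mu> u x) + 2 * ((K1 + K2) * real n powr (- \<gamma>))" by linarith
  also have "2 * ((K1 + K2) * real n powr (- \<gamma>))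
      = 2 * (K1 + K2) * real n powr (- 1 / (4 * real CARD('d)))"
    by (simp only: \<gamma>_def d_def mult.assoc minus_divide_left)
  finally show "limit_risk \<mu> u n \<le> (INF x. pop_risk \<mu> u x)
      + 2 * (K1 + K2) * real n powr (- 1 / (4 * real CARD('d)))" .
qed

lemma limit_risk_tendsto:
  "(\<lambda>n. limit_risk \<mu> u n - (INF x. pop_risk \<mu> u x)) \<longlonglongrightarrow> 0"
proof -
  obtain K where K: "K \<ge> 0" "\<And>n. n \<ge> 1 \<Longrightarrow>
    limit_risk \<mu> u n \<le> (INF x. pop_risk \<mu> u x) + K * real n powr (- 1 / (4 * real CARD('d)))"
    using limit_risk_polynomial_rate by blast
  have "- 1 / (4 * real CARD('d)) < 0" by (simp add: divide_less_0_iff)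
  then have "(\<lambda>n. real n powr (- 1 / (4 * real CARD('d)))) \<longlonglongrightarrow> 0"
    by (intro tendsto_neg_powr filterlim_real_sequentially)
  then have up: "(\<lambda>n. K * real n powr (- 1 / (4 * real CARD('d)))) \<longlonglongrightarrow> 0"
    by (rule tendsto_mult_right_zero)
  show ?thesis
  proof (rule real_tendsto_sandwich[OF _ _ tendsto_const up])
    show "\<forall>\<^sub>F n in sequentially. 0 \<le> limit_risk \<mu> u n - (INF x. pop_risk \<mu> u x)"
      using eventually_ge_at_top[of "1::nat"]
      by eventually_elim (use limit_risk_bounds(1)[of _ 1] in simp)
    show "\<forall>\<^sub>F n in sequentially. limit_risk \<mu> u n - (INF x. pop_risk \<mu> u x)
        \<le> K * real n powr (- 1 / (4 * real CARD('d)))"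
      using eventually_ge_at_top[of "1::nat"]
      by eventually_elim (use K(2) in \<open>simp add: algebra_simps\<close>)
  qed
qed

text \<open>
  The logarithm is dominated by every positive power, and an exponent \<open>s \<le> 1\<close> does no harm once
  \<open>ln n \<ge> 1\<close>; this is where \<open>n \<ge> 3\<close> comes from.
\<close>

lemma limit_risk_log_rate:
  assumes s: "s \<le> 1"
  shows "\<exists>C\<ge>0. \<forall>n\<ge>3.
    limit_risk \<mu> u n - (INF x. pop_risk \<mu> u x) \<le> C / ln (real n) powr s"
proof -
  obtain K where K: "K \<ge> 0" "\<And>n. n \<ge> 1 \<Longrightarrow>
    limit_risk \<mu> u n \<le> (INF x. pop_risk \<mu> u x) + K * real n powr (- 1 / (4 * real CARD('d)))"
    using limit_risk_polynomial_rate by blast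
  define \<gamma> where "\<gamma> = 1 / (4 * real CARD('d))"
  have \<gamma>: "\<gamma> > 0" by (simp add: \<gamma>_def)
  show ?thesis
  proof (intro exI conjI allI impI)
    show "K / \<gamma> \<ge> 0" using K \<gamma> by simp
    fix n :: nat assume n: "n \<ge> 3"
    have "ln (real n) \<ge> 1"
    proof -
      have "exp 1 \<le> real n" using exp_le n by linarith
      then show ?thesis using n by (simp add: ln_ge_iff)
    qed
    then have ln_pos: "ln (real n) powr s > 0" by simp
    have "ln (real n) powr s \<le> ln (real n) powr 1"
      using s \<open>ln (real n) \<ge> 1\<close> by (rule powr_mono)
    moreover have "ln (real n) \<le> real n powr \<gamma> / \<gamma>" using n \<gamma> by (intro ln_powr_bound) auto
    ultimately have *: "ln (real n) powr s \<le> real n powr \<gamma> / \<gamma>"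
      using \<open>ln (real n) \<ge> 1\<close> by simp
    have "limit_risk \<mu> u n - (INF x. pop_risk \<mu> u x) \<le> K * real n powr (- \<gamma>)"
      using K(2)[of n] n by (simp add: \<gamma>_def)
    also have "\<dots> = K / \<gamma> / (real n powr \<gamma> / \<gamma>)" using \<gamma> by (simp add: powr_minus_divide)
    also have "\<dots> \<le> K / \<gamma> / ln (real n) powr s"
      using K \<gamma> ln_pos * n by (intro divide_left_mono mult_pos_pos) auto
    finally show "limit_risk \<mu> u n - (INF x. pop_risk \<mu> u x) \<le> K / \<gamma> / ln (real n) powr s" .
  qed
qed

end

theorem proposition9:
  fixes u :: "real ^ 'd \<Rightarrow> 'z::topological_space \<Rightarrow> real"
    and \<mu> :: "'z measure"
    and Y :: "nat \<Rightarrow> 'y measure"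
    and R :: "nat \<Rightarrow> (nat \<Rightarrow> 'z) \<Rightarrow> 'y measure"
    and g :: "nat \<Rightarrow> real ^ 'd \<Rightarrow> 'y \<Rightarrow> real ^ 'd"
    and A B M m c \<kappa> :: real
  assumes "prob_space \<mu>" and "sets \<mu> = sets borel"
    and "\<And>x z. u x z \<ge> 0"
    and "\<And>n. n \<ge> 1 \<Longrightarrow> R n \<in> sample_measure \<mu> n \<rightarrow>\<^sub>M prob_algebra (Y n)"
    and "\<And>n x z. n \<ge> 1 \<Longrightarrow> z \<in> space (sample_measure \<mu> n) \<Longrightarrow>
           has_bochner_integral (R n z) (g n x) (grad (emp_risk u n z) x)"
    and "\<And>z. smooth (\<lambda>x. u x z)"
    and A1: "A \<ge> 0" "B \<ge> 0"
      "\<And>z. \<bar>u 0 z\<bar> \<le> A" "\<And>z. norm (grad (\<lambda>x. u x z) 0) \<le> B"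
    and A2: "M \<ge> 0"
      "\<And>x1 x2 z. norm (grad (\<lambda>x. u x z) x1 - grad (\<lambda>x. u x z) x2) \<le> M * norm (x1 - x2)"
      "\<And>x1 x2 z. norm (hessian (\<lambda>x. u x z) x1 - hessian (\<lambda>x. u x z) x2) \<le> M * norm (x1 - x2)"
      "\<And>x1 x2 z. norm (third_deriv (\<lambda>x. u x z) x1 - third_deriv (\<lambda>x. u x z) x2)
                   \<le> M * norm (x1 - x2)"
    and A3: "m > 0" "c \<ge> 0"
      "\<And>x z. grad (\<lambda>x. u x z) x \<bullet> x \<ge> m * (norm x)\<^sup>2 - c"
    and A4: "\<kappa> \<ge> 0"
      "\<And>n x. n \<ge> 1 \<Longrightarrow>
         (\<integral>\<^sup>+ z. (\<integral>\<^sup>+ y. ennreal ((norm (grad (emp_risk u n z) x - g n x y))\<^sup>2) \<partial>R n z)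
            \<partial>sample_measure \<mu> n) \<le> ennreal (\<kappa> * (1 + (norm x)\<^sup>2))"
    and "continuous_on UNIV (\<lambda>(x, z). u x z)"
    and B1: "compact (UNIV :: 'z set)"
    and B2: "\<And>\<beta>. \<beta> > 0 \<Longrightarrow>
      (SUP n\<in>{1..}. \<integral>\<^sup>+ z. sigma_star \<beta> (emp_risk u n z) \<partial>sample_measure \<mu> n) < \<infinity>"
    and barrier_lim: "((\<lambda>\<epsilon>. SUP n\<in>{1..}. barrier_term \<mu> u n \<epsilon>) \<longlongrightarrow> 0) (at_right 0)"
  shows "((\<lambda>n. limit_risk \<mu> u n - (INF x. pop_risk \<mu> u x)) \<longlonglongrightarrow> 0) \<and>
    (\<forall>C0 a \<epsilon>0. C0 > 0 \<and> a > 0 \<and> \<epsilon>0 > 0 \<and>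
        (\<forall>n\<ge>1. \<forall>\<epsilon>\<in>{0<..\<epsilon>0}. barrier_term \<mu> u n \<epsilon> \<le> ennreal (C0 * \<epsilon> powr a)) \<longrightarrow>
      (\<forall>\<eta>\<in>{0<..<1}. \<exists>C\<ge>0. \<exists>n0. \<forall>n\<ge>n0.
        limit_risk \<mu> u n - (INF x. pop_risk \<mu> u x)
          \<le> C / ln (real n) powr (min (1/4) (a/2) * \<eta>)))"
proof -
  interpret nondegenerate_risk u \<mu> A B M m c
  proof (intro nondegenerate_risk.intro dissipative_risk.intro nondegenerate_risk_axioms.intro)
    show "prob_space \<mu>" "sets \<mu> = sets borel" by fact+
    show "smooth (\<lambda>x. u x z)" "\<bar>u 0 z\<bar> \<le> A" "norm (grad (\<lambda>x. u x z) 0) \<le> B" for z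
      by fact+
    show "u x z \<ge> 0" "grad (\<lambda>x. u x z) x \<bullet> x \<ge> m * (norm x)\<^sup>2 - c" for x z
      by fact+
    show "norm (grad (\<lambda>x. u x z) x - grad (\<lambda>x. u x z) y) \<le> M * norm (x - y)" for x y z
      by fact
    show "M \<ge> 0" "m > 0" "c \<ge> 0" "continuous_on UNIV (\<lambda>(x, z). u x z)" by fact+
    show "(\<integral>\<^sup>+ z. sigma_star 1 (emp_risk u n z) \<partial>sample_measure \<mu> n) < \<infinity>" if "n \<ge> 1" for n
      by (rule le_less_trans[OF SUP_upper B2[of 1]]) (use that in auto)
  qed
  have "\<exists>C\<ge>0. \<exists>n0. \<forall>n\<ge>n0. limit_risk \<mu> u n - (INF x. pop_risk \<mu> u x)
      \<le> C / ln (real n) powr (min (1/4) (a/2) * \<eta>)" if "a > 0" "\<eta> \<in> {0<..<1}" for a \<eta> :: real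
  proof -
    have "min (1/4) (a/2) * \<eta> \<le> 1/4 * 1"
      using that by (intro mult_mono) auto
    then have "min (1/4) (a/2) * \<eta> \<le> 1" by simp
    from limit_risk_log_rate[OF this] show ?thesis by blast
  qed
  then show ?thesis by (intro conjI allI impI ballI limit_risk_tendsto) (elim conjE)
qed

end
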